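(* Let $A(z)$ be an $n\times n$ Hermite matrix of Laurent polynomials with $\det A(z)\not\equiv0$. Suppose that (1) $\nu_+(A(z))-\nu_-(A(z))$ is constant for $z\in\mathbb{T}\setminus\sigma(A)$, and (2) there exists $z_0\in\sigma(A)\cap\mathbb{T}$ such that every elementary divisor of $A(z)$ of the form $(z-z_0)^\alpha$ has $\alpha=1$. Then there exist $n\times n$ matrices $U(z)$ and $\widetilde A(z)$ of Laurent polynomials with $\widetilde A^\star=\widetilde A$, $A(z)=U(z)\widetilde A(z)U^\star(z)$ and $\operatorname{len}(\det\widetilde A(z))\le\operatorname{len}(\det A(z))-2$.
   Context: For a matrix $U(z)=\sum_k U_k z^k$ of Laurent polynomials, $U^\star(z):=\sum_k\overline{U_k}^T z^{-k}$; Hermite means $A^\star=A$. $\mathbb{T}$ is the unit circle; $\sigma(A):=\{z\in\mathbb{C}\setminus\{0\}:\det A(z)=0\}$; $\nu_\pm(H)$ are the numbers of positive/negative eigenvalues of a Hermitian matrix $H$. For a Laurent polynomial $u\not\equiv0$, $\operatorname{len}(u)$ is its highest degree minus its lowest degree. A matrix of Laurent polynomials is unimodular if its determinant is a nonzero monomial. Every $n\times n$ matrix $A(z)$ of Laurent polynomials with $\det A\not\equiv0$ factors as $A=E\operatorname{diag}(d_1,\dots,d_n)F$ with $E,F$ unimodular and polynomials $d_j$ with $d_j\mid d_{j+1}$, leading coefficient 1 and nonzero constant term (Smith normal form); the $d_j$ are the invariant polynomials. Writing $d_j(z)=\prod_k(z-z_{j,k})^{\alpha_{j,k}}$ with distinct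 $z_{j,k}$, the factors $(z-z_{j,k})^{\alpha_{j,k}}$ (over all $j$) are the elementary divisors of $A$. *)

theory Defs
  imports "Jordan_Normal_Form.Determinant" "Jordan_Normal_Form.Char_Poly"
    "HOL-Computational_Algebra.Formal_Laurent_Series"
    "HOL-Computational_Algebra.Polynomial_FPS"
begin

no_notation fls_nth (infixl \<open>$$\<close> 75)

text \<open>Laurent polynomials over the complex numbers are represented as formal Laurent
  series (type complex fls) with only finitely many nonzero coefficients.\<close>

definition is_lp :: "complex fls \<Rightarrow> bool" where
  "is_lp f \<longleftrightarrow> finite {k. fls_nth f k \<noteq> 0}"

definition lp_mat :: "complex fls mat \<Rightarrow> bool" where
  "lp_mat A \<longleftrightarrow> (\<forall>i < dim_row A. \<forall>j < dim_col A. is_lp (A $$ (i,j)))"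

definition lp_star :: "complex fls \<Rightarrow> complex fls" where
  "lp_star f = Abs_fls (\<lambda>k. cnj (fls_nth f (- k)))"

definition mat_star :: "complex fls mat \<Rightarrow> complex fls mat" where
  "mat_star A = mat (dim_col A) (dim_row A) (\<lambda>(i,j). lp_star (A $$ (j,i)))"

definition lp_eval :: "complex fls \<Rightarrow> complex \<Rightarrow> complex" where
  "lp_eval f z = (\<Sum>k\<in>{k. fls_nth f k \<noteq> 0}. fls_nth f k * z powi k)"

definition lp_mat_eval :: "complex fls mat \<Rightarrow> complex \<Rightarrow> complex mat" where
  "lp_mat_eval A z = map_mat (\<lambda>f. lp_eval f z) A"

definition lp_sigma :: "complex fls mat \<Rightarrow> complex set" where
  "lp_sigma A = {z. z \<noteq> 0 \<and> det (lp_mat_eval A z) = 0}"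

definition nu_pos :: "complex mat \<Rightarrow> nat" where
  "nu_pos H = (\<Sum>x\<in>{x. poly (char_poly H) x = 0 \<and> Im x = 0 \<and> Re x > 0}. order x (char_poly H))"

definition nu_neg :: "complex mat \<Rightarrow> nat" where
  "nu_neg H = (\<Sum>x\<in>{x. poly (char_poly H) x = 0 \<and> Im x = 0 \<and> Re x < 0}. order x (char_poly H))"

definition lp_len :: "complex fls \<Rightarrow> int" where
  "lp_len f = Max {k. fls_nth f k \<noteq> 0} - Min {k. fls_nth f k \<noteq> 0}"

definition poly_to_lp :: "complex poly \<Rightarrow> complex fls" where
  "poly_to_lp p = fps_to_fls (fps_of_poly p)"

definition unimodular :: "complex fls mat \<Rightarrow> bool" where
  "unimodular E \<longleftrightarrow> (\<exists>c k. c \<noteq> 0 \<and> det E = fls_const c * fls_X_intpow k)"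

definition smith_form ::
  "nat \<Rightarrow> complex fls mat \<Rightarrow> complex fls mat \<Rightarrow> complex fls mat \<Rightarrow> (nat \<Rightarrow> complex poly) \<Rightarrow> bool" where
  "smith_form n A E F d \<longleftrightarrow>
     E \<in> carrier_mat n n \<and> F \<in> carrier_mat n n \<and> lp_mat E \<and> lp_mat F \<and>
     unimodular E \<and> unimodular F \<and>
     (\<forall>j < n. lead_coeff (d j) = 1 \<and> poly (d j) 0 \<noteq> 0) \<and>
     (\<forall>j. Suc j < n \<longrightarrow> d j dvd d (Suc j)) \<and>
     A = E * mat n n (\<lambda>(i,j). if i = j then poly_to_lp (d i) else 0) * F"

end

theory Submission
  imports "HOL-Analysis.Derivative" "Jordan_Normal_Form.Schur_Decomposition" Defs
begin

text \<open>The idea is to find a vector \<open>v \<noteq> 0\<close> in the kernel of \<open>A(z0)\<close> that is isotropic for the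
  derivative of \<open>A\<close> along the circle at \<open>z0\<close>. If there were none, that derivative would be definite on
  the kernel, and when the point crosses \<open>z0\<close> all eigenvalues of \<open>A\<close> vanishing at \<open>z0\<close> would change sign
  in the same direction, so the signature would jump. Given \<open>v\<close>, a constant change of basis with \<open>v\<close> as one
  of the basis vectors makes the corresponding row and column of \<open>A\<close> divisible by \<open>X - z0\<close> and its star,
  and the common diagonal entry by their product; splitting these factors off lowers the length of the
  determinant by two.\<close>

no_notation fps_nth (infixl \<open>$\<close> 75)

section \<open>Laurent polynomials\<close>

text \<open>The derivative is taken in the angle t, not in z: A(z0 e^(it)) is Hermitian for every
  real t, so its t-derivative is Hermitian and its quadratic form is real, which the derivative in z
  does not provide. A real form without isotropic vectors on a subspace is definite there, since a
  segment from a positive to a negative vector would meet a zero of the form away from the origin.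
  Eigenvalues are never followed as functions of t: their signs on both sides of z0 are bounded by
  comparing dimensions of subspaces on which the forms are definite, so no regularity of eigenvalue
  branches enters. Isotropy becomes divisibility because v^* A v vanishes at z0 together with its
  angular derivative, hence has a double root there, and for z0 on the circle X - z0 and its star
  differ only by a unit.\<close>

definition lp_monom :: "complex \<Rightarrow> int \<Rightarrow> complex fls" where
  "lp_monom c k = fls_shift (-k) (fls_const c)"

lemma lp_monom_nth [simp]: "fls_nth (lp_monom c k) j = (if j = k then c else 0)"
  by (auto simp: lp_monom_def)

lemma lp_monom_times_nth [simp]: "fls_nth (lp_monom c k * f) j = c * fls_nth f (j - k)"
  by (simp add: lp_monom_def fls_shifted_times_simps(2) flip: fls_times_both_shifted_simp)

lemma is_lp_0 [simp]: "is_lp 0"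
  by (simp add: is_lp_def)

lemma is_lp_monom [simp]: "is_lp (lp_monom c k)"
  unfolding is_lp_def by (rule finite_subset[of _ "{k}"]) auto

lemma is_lp_add [simp]: "is_lp f \<Longrightarrow> is_lp g \<Longrightarrow> is_lp (f + g)"
  unfolding is_lp_def
  by (rule finite_subset[of _ "{k. fls_nth f k \<noteq> 0} \<union> {k. fls_nth g k \<noteq> 0}"]) auto

text \<open>A Laurent polynomial is a finite sum of monomials, peeled off one exponent of the
  support at a time. Multiplicative facts thereby reduce to multiplication by a monomial, which only
  shifts coefficients, so the convolution formula is never unfolded.\<close>

lemma lp_induct [consumes 1, case_names zero add]:
  assumes "is_lp f" "P 0"
    and step: "\<And>c k f. is_lp f \<Longrightarrow> P f \<Longrightarrow> P (lp_monom c k + f)"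
  shows "P f"
proof -
  have "finite S \<Longrightarrow> {k. fls_nth f k \<noteq> 0} = S \<Longrightarrow> P f" for S f
  proof (induction S arbitrary: f rule: finite_induct)
    case empty
    then have "f = 0" by (intro fls_eqI) auto
    then show ?case using assms(2) by simp
  next
    case (insert k S)
    define g where "g = f - lp_monom (fls_nth f k) k"
    have g: "{k. fls_nth g k \<noteq> 0} = S"
      using insert(2,4) by (auto simp: g_def)
    then have "is_lp g" using insert(1) by (simp add: is_lp_def)
    from step[OF this insert.IH[OF g], of "fls_nth f k" k] show ?case
      by (simp add: g_def)
  qed
  then show ?thesis using assms(1) by (auto simp: is_lp_def)
qed

lemma is_lp_monom_mult: "is_lp f \<Longrightarrow> is_lp (lp_monom c k * f)"
  unfolding is_lp_def
  by (rule finite_subset[of _ "(\<lambda>j. j + k) ` {k. fls_nth f k \<noteq> 0}"])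
     (auto simp: image_iff intro!: exI[of _ "_ - k"])

lemma is_lp_mult [simp]: "is_lp f \<Longrightarrow> is_lp g \<Longrightarrow> is_lp (f * g)"
  by (induction f rule: lp_induct) (simp_all add: distrib_right is_lp_monom_mult)

lemma lp_monom_const: "fls_const c = lp_monom c 0"
  by (simp add: lp_monom_def)

lemma lp_monom_1: "lp_monom 1 0 = 1"
  by (simp add: lp_monom_def)

lemma is_lp_const [simp]: "is_lp (fls_const c)"
  by (simp add: lp_monom_const)

lemma is_lp_1 [simp]: "is_lp 1"
  by (simp flip: lp_monom_1)

lemma lp_monom_neg_1: "lp_monom (-1) 0 = -1"
  by (intro fls_eqI) simp

lemma is_lp_uminus [simp]: "is_lp f \<Longrightarrow> is_lp (- f)"
  using is_lp_mult[OF is_lp_monom[of "-1" 0], of f] by (simp add: lp_monom_neg_1)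

lemma is_lp_diff [simp]: "is_lp f \<Longrightarrow> is_lp g \<Longrightarrow> is_lp (f - g)"
  using is_lp_add[of f "-g"] by simp

lemma is_lp_sum [simp]: "(\<And>i. i \<in> S \<Longrightarrow> is_lp (f i)) \<Longrightarrow> is_lp (sum f S)"
  by (induction S rule: infinite_finite_induct) auto

lemma is_lp_prod [simp]: "(\<And>i. i \<in> S \<Longrightarrow> is_lp (f i)) \<Longrightarrow> is_lp (prod f S)"
  by (induction S rule: infinite_finite_induct) auto

section \<open>The star involution\<close>

lemma lp_star_nth:
  assumes "is_lp f"
  shows "fls_nth (lp_star f) k = cnj (fls_nth f (- k))"
proof -
  \<comment> \<open>\<open>Abs_fls\<close> returns the given coefficients for a family that vanishes
    below some bound. After reversal such a bound comes from the top degree of \<open>f\<close>,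
    hence the appeal to finite support.\<close>
  have "finite (uminus ` {k. fls_nth f k \<noteq> 0})"
    using assms by (simp add: is_lp_def)
  then obtain N where N: "\<And>k. fls_nth f k \<noteq> 0 \<Longrightarrow> N \<le> - k"
    using bdd_below_finite[of "uminus ` {k. fls_nth f k \<noteq> 0}"]
    by (force simp: bdd_below_def)
  have "\<forall>k<N. cnj (fls_nth f (- k)) = 0"
    using N by force
  then show ?thesis unfolding lp_star_def by (subst nth_Abs_fls_lower_bound) auto
qed

lemma is_lp_star [simp]: "is_lp f \<Longrightarrow> is_lp (lp_star f)"
  unfolding is_lp_def[of "lp_star f"]
  by (rule finite_subset[of _ "uminus ` {k. fls_nth f k \<noteq> 0}"])
     (auto simp: lp_star_nth is_lp_def image_iff intro!: exI[of _ "- _"])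

lemma lp_star_add: "is_lp f \<Longrightarrow> is_lp g \<Longrightarrow> lp_star (f + g) = lp_star f + lp_star g"
  by (intro fls_eqI) (simp add: lp_star_nth)

lemma lp_star_0 [simp]: "lp_star 0 = 0"
  by (intro fls_eqI) (simp add: lp_star_nth)

lemma lp_star_star [simp]: "is_lp f \<Longrightarrow> lp_star (lp_star f) = f"
  by (intro fls_eqI) (simp add: lp_star_nth)

lemma lp_star_monom [simp]: "lp_star (lp_monom c k) = lp_monom (cnj c) (- k)"
  by (intro fls_eqI) (auto simp: lp_star_nth)

lemma lp_star_mult: "is_lp f \<Longrightarrow> is_lp g \<Longrightarrow> lp_star (f * g) = lp_star f * lp_star g"
proof (induction f rule: lp_induct)
  case (add c k f)
  have "lp_star (lp_monom c k * g) = lp_star (lp_monom c k) * lp_star g"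
    using add.prems by (intro fls_eqI) (simp add: lp_star_nth)
  then show ?case using add by (simp add: distrib_right lp_star_add)
qed simp

lemma lp_star_sum:
  "(\<And>i. i \<in> S \<Longrightarrow> is_lp (f i)) \<Longrightarrow> lp_star (sum f S) = (\<Sum>i\<in>S. lp_star (f i))"
  by (induction S rule: infinite_finite_induct) (auto simp: lp_star_add)

lemma lp_star_const [simp]: "lp_star (fls_const c) = fls_const (cnj c)"
  by (simp add: lp_monom_const)

lemma lp_star_1 [simp]: "lp_star 1 = 1"
  by (simp flip: lp_monom_1)

lemma lp_star_uminus: "is_lp f \<Longrightarrow> lp_star (- f) = - lp_star f"
  by (intro fls_eqI) (simp add: lp_star_nth)

section \<open>Evaluation as a ring homomorphism away from zero\<close>

lemma lp_eval_superset:
  assumes "finite S" "{k. fls_nth f k \<noteq> 0} \<subseteq> S"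
  shows "lp_eval f z = (\<Sum>k\<in>S. fls_nth f k * z powi k)"
  unfolding lp_eval_def using assms by (intro sum.mono_neutral_left) auto

lemma lp_eval_0 [simp]: "lp_eval 0 z = 0"
  by (simp add: lp_eval_def)

lemma lp_eval_add:
  assumes "is_lp f" "is_lp g"
  shows "lp_eval (f + g) z = lp_eval f z + lp_eval g z"
proof -
  let ?S = "{k. fls_nth f k \<noteq> 0} \<union> {k. fls_nth g k \<noteq> 0}"
  have S: "finite ?S" using assms by (simp add: is_lp_def)
  have "{k. fls_nth (f + g) k \<noteq> 0} \<subseteq> ?S" by auto
  then show ?thesis
    using S by (simp add: lp_eval_superset[OF S] sum.distrib distrib_right)
qed

lemma lp_eval_monom [simp]: "lp_eval (lp_monom c k) z = c * z powi k"
  by (subst lp_eval_superset[of "{k}"]) auto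

text \<open>Exponents in \<open>z powi k\<close> add only for nonzero \<open>z\<close>, since
  negative powers of 0 have the default value 0. This is the origin of \<open>z \<noteq> 0\<close>
  in the product rules that follow.\<close>

lemma lp_eval_monom_mult:
  assumes "z \<noteq> 0" "is_lp f"
  shows "lp_eval (lp_monom c k * f) z = c * z powi k * lp_eval f z"
  using assms(2)
proof (induction f rule: lp_induct)
  case (add d j f)
  have "lp_monom c k * lp_monom d j = lp_monom (c * d) (k + j)"
    by (intro fls_eqI) auto
  then show ?case using add assms(1)
    by (simp add: distrib_left lp_eval_add is_lp_monom_mult power_int_add)
qed simp

lemma lp_eval_mult:
  assumes "z \<noteq> 0" "is_lp f" "is_lp g"
  shows "lp_eval (f * g) z = lp_eval f z * lp_eval g z"
  using assms(2)
proof (induction f rule: lp_induct)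
  case (add c k f)
  then show ?case using assms
    by (simp add: distrib_right lp_eval_add is_lp_monom_mult lp_eval_monom_mult)
qed simp

lemma lp_eval_const [simp]: "lp_eval (fls_const c) z = c"
  by (simp add: lp_monom_const)

lemma lp_eval_1 [simp]: "lp_eval 1 z = 1"
  by (simp flip: lp_monom_1)

lemma lp_eval_uminus: "is_lp f \<Longrightarrow> lp_eval (- f) z = - lp_eval f z"
  using lp_eval_add[of f "- f" z] by (simp add: eq_neg_iff_add_eq_0 add.commute)

lemma lp_eval_diff: "is_lp f \<Longrightarrow> is_lp g \<Longrightarrow> lp_eval (f - g) z = lp_eval f z - lp_eval g z"
  using lp_eval_add[of f "- g" z] by (simp add: lp_eval_uminus)

lemma lp_eval_sum:
  "(\<And>i. i \<in> S \<Longrightarrow> is_lp (f i)) \<Longrightarrow> lp_eval (sum f S) z = (\<Sum>i\<in>S. lp_eval (f i) z)"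
  by (induction S rule: infinite_finite_induct) (auto simp: lp_eval_add)

lemma lp_eval_prod:
  "z \<noteq> 0 \<Longrightarrow> (\<And>i. i \<in> S \<Longrightarrow> is_lp (f i)) \<Longrightarrow> lp_eval (prod f S) z = (\<Prod>i\<in>S. lp_eval (f i) z)"
  by (induction S rule: infinite_finite_induct) (auto simp: lp_eval_mult)

text \<open>On the circle \<open>cnj z\<close> is the inverse of \<open>z\<close>, so the formal
  star becomes pointwise conjugation; a self-star matrix is therefore Hermitian at every point of
  the circle.\<close>

lemma lp_eval_star:
  assumes "cmod z = 1" "is_lp f"
  shows "lp_eval (lp_star f) z = cnj (lp_eval f z)"
  using assms(2)
proof (induction f rule: lp_induct)
  case (add c k f)
  have "cnj z * z = 1"
    using assms(1) complex_norm_square[of z] by (simp add: mult.commute)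
  then have "cnj z = inverse z"
    by (metis inverse_unique mult.commute)
  then have "cnj (z powi k) = z powi (- k)"
    by (simp add: power_int_minus power_int_inverse)
  then show ?case using add by (simp add: lp_star_add lp_eval_add)
qed simp

section \<open>Reduction to ordinary polynomials and additivity of the length\<close>

lemma lp_X_eq: "fls_X = lp_monom 1 1"
  by (intro fls_eqI) auto

lemma poly_to_lp_0 [simp]: "poly_to_lp 0 = 0"
  by (simp add: poly_to_lp_def)

lemma poly_to_lp_pCons: "poly_to_lp (pCons a p) = lp_monom a 0 + lp_monom 1 1 * poly_to_lp p"
  by (simp add: poly_to_lp_def fps_of_poly_pCons fls_times_fps_to_fls lp_monom_const lp_X_eq
      flip: lp_monom_const mult.commute)

lemma poly_to_lp_nth: "fls_nth (poly_to_lp p) k = (if k < 0 then 0 else coeff p (nat k))"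
  by (simp add: poly_to_lp_def)

lemma poly_to_lp_mult: "poly_to_lp (p * q) = poly_to_lp p * poly_to_lp q"
  by (simp add: poly_to_lp_def fps_of_poly_mult fls_times_fps_to_fls)

lemma is_lp_poly_to_lp [simp]: "is_lp (poly_to_lp p)"
  by (induction p) (auto simp: poly_to_lp_pCons)

lemma lp_eval_poly_to_lp: "z \<noteq> 0 \<Longrightarrow> lp_eval (poly_to_lp p) z = poly p z"
  by (induction p) (auto simp: poly_to_lp_pCons lp_eval_add lp_eval_monom_mult)

text \<open>Dividing by the lowest power present leaves an ordinary polynomial with nonzero constant
  term. Root factorization, finiteness of the zeros and the length are all read off from it.\<close>

lemma lp_normal_form:
  assumes "is_lp f" "f \<noteq> 0"
  obtains p m where "f = lp_monom 1 m * poly_to_lp p" "coeff p 0 \<noteq> 0"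
proof -
  let ?S = "{k. fls_nth f k \<noteq> 0}"
  have S: "finite ?S" "?S \<noteq> {}"
    using assms fls_nonzero_nth[of f] by (auto simp: is_lp_def)
  define m where "m = Min ?S"
  have m: "fls_nth f m \<noteq> 0" "\<And>k. fls_nth f k \<noteq> 0 \<Longrightarrow> m \<le> k"
    using Min_in[OF S] S by (auto simp: m_def)
  define p where "p = Abs_poly (\<lambda>i. fls_nth f (m + int i))"
  have "finite {i::nat. fls_nth f (m + int i) \<noteq> 0}"
    by (rule finite_subset[OF _ finite_imageI[OF S(1), of "\<lambda>k. nat (k - m)"]])
       (auto simp: image_iff intro!: exI[of _ "m + int _"])
  then have p: "coeff p i = fls_nth f (m + int i)" for i
    unfolding p_def by (subst Abs_poly_inverse) (auto simp: MOST_iff_cofinite)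
  show ?thesis
  proof
    show "f = lp_monom 1 m * poly_to_lp p"
      using m(2) by (intro fls_eqI) (force simp: poly_to_lp_nth p)
    show "coeff p 0 \<noteq> 0" using m(1) by (simp add: p)
  qed
qed

lemma lp_len_normal_form:
  assumes "coeff p 0 \<noteq> 0"
  shows "lp_len (lp_monom 1 m * poly_to_lp p) = int (degree p)"
proof -
  let ?S = "{k. fls_nth (lp_monom 1 m * poly_to_lp p) k \<noteq> 0}"
  have fin: "finite ?S"
    using is_lp_monom_mult[OF is_lp_poly_to_lp] by (simp only: is_lp_def)
  have "Min ?S = m"
    using assms by (intro Min_eqI fin) (auto simp: poly_to_lp_nth split: if_splits)
  moreover have "Max ?S = m + int (degree p)"
  proof (intro Max_eqI fin)
    show "m + int (degree p) \<in> ?S"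
      using assms by (auto simp: poly_to_lp_nth)
    fix y assume "y \<in> ?S"
    then have "nat (y - m) \<le> degree p" by (auto simp: poly_to_lp_nth intro!: le_degree split: if_splits)
    then show "y \<le> m + int (degree p)" by linarith
  qed
  ultimately show ?thesis by (simp add: lp_len_def)
qed

text \<open>The length is the degree of the polynomial part, and degrees add over a field. The
  constant terms multiply to a nonzero one, so the product is again in normal form.\<close>

lemma lp_len_mult:
  assumes "is_lp f" "f \<noteq> 0" "is_lp g" "g \<noteq> 0"
  shows "lp_len (f * g) = lp_len f + lp_len g"
proof -
  obtain p m where p: "f = lp_monom 1 m * poly_to_lp p" "coeff p 0 \<noteq> 0"
    using lp_normal_form assms(1,2) by blast
  obtain q k where q: "g = lp_monom 1 k * poly_to_lp q" "coeff q 0 \<noteq> 0"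
    using lp_normal_form assms(3,4) by blast
  have "lp_monom 1 m * lp_monom 1 k = lp_monom 1 (m + k)"
    by (intro fls_eqI) auto
  then have "f * g = lp_monom 1 (m + k) * poly_to_lp (p * q)"
    unfolding p q poly_to_lp_mult by (metis mult.assoc mult.left_commute)
  moreover have "coeff (p * q) 0 \<noteq> 0" using p q by (simp add: coeff_mult_0)
  moreover have "degree (p * q) = degree p + degree q"
    using p q by (intro degree_mult_eq) auto
  ultimately show ?thesis
    using p q by (simp add: lp_len_normal_form)
qed

lemma finite_lp_zeros:
  assumes "is_lp f" "f \<noteq> 0"
  shows "finite {z. z \<noteq> 0 \<and> lp_eval f z = 0}"
proof -
  obtain p m where p: "f = lp_monom 1 m * poly_to_lp p" "coeff p 0 \<noteq> 0"
    using lp_normal_form assms(1,2) by blast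
  then have "finite {z. poly p z = 0}" by (intro poly_roots_finite) auto
  moreover have "{z. z \<noteq> 0 \<and> lp_eval f z = 0} \<subseteq> {z. poly p z = 0}"
    by (auto simp: p(1) lp_eval_monom_mult lp_eval_poly_to_lp)
  ultimately show ?thesis by (rule finite_subset[rotated])
qed

section \<open>Linear factors and differentiation along the circle\<close>

definition X_minus :: "complex \<Rightarrow> complex fls" where
  "X_minus w = lp_monom 1 1 - lp_monom w 0"

lemma X_minus_poly: "X_minus w = poly_to_lp [:- w, 1:]"
  by (intro fls_eqI) (auto simp: X_minus_def poly_to_lp_nth coeff_pCons nat_eq_iff split: nat.splits)

lemma is_lp_X_minus [simp]: "is_lp (X_minus w)"
  by (simp add: X_minus_poly)

lemma lp_root_factor:
  assumes "is_lp f" "z \<noteq> 0" "lp_eval f z = 0"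
  obtains g where "is_lp g" "f = X_minus z * g"
proof (cases "f = 0")
  case False
  obtain p m where p: "f = lp_monom 1 m * poly_to_lp p" "coeff p 0 \<noteq> 0"
    using lp_normal_form assms(1) False by blast
  then have "poly p z = 0"
    using assms by (simp add: p(1) lp_eval_monom_mult lp_eval_poly_to_lp)
  then obtain q where q: "p = [:- z, 1:] * q"
    by (auto simp: poly_eq_0_iff_dvd dvd_def)
  show ?thesis
  proof
    show "f = X_minus z * (lp_monom 1 m * poly_to_lp q)"
      by (simp only: p(1) q poly_to_lp_mult X_minus_poly mult_ac)
  qed simp
qed (use that[of 0] in simp)

lemma lp_len_X_minus: "w \<noteq> 0 \<Longrightarrow> lp_len (X_minus w) = 1"
  using lp_len_normal_form[of "[:- w, 1:]" 0] by (simp add: X_minus_poly lp_monom_1)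

text \<open>Since \<open>cnj w * w = 1\<close>, z^(-1) - cnj w equals - cnj w z^(-1) (z - w): for a
  point of the circle the linear factor is its own star up to a unit.\<close>

lemma X_minus_star: "cmod w = 1 \<Longrightarrow> lp_star (X_minus w) = lp_monom (- cnj w) (-1) * X_minus w"
proof (intro fls_eqI)
  fix k
  assume w: "cmod w = 1"
  have "cnj w * w = 1"
    using w complex_norm_square[of w] by (simp add: mult.commute)
  then show "fls_nth (lp_star (X_minus w)) k = fls_nth (lp_monom (- cnj w) (-1) * X_minus w) k"
    by (subst lp_star_nth) (auto simp: X_minus_def)
qed

lemma lp_eval_X_minus: "lp_eval (X_minus w) z = z - w"
  by (simp add: X_minus_def lp_eval_diff)

text \<open>Each monomial becomes a constant times e^(ikt). Existence suffices, because the value of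
  the derivative is later pinned down by uniqueness.\<close>

lemma lp_eval_circle_deriv:
  fixes w :: complex
  assumes "w \<noteq> 0" "is_lp f"
  shows "\<exists>D. ((\<lambda>t. lp_eval f (w * cis t)) has_vector_derivative D) (at t)"
  using assms(2)
proof (induction f rule: lp_induct)
  case zero
  then show ?case by (auto intro!: exI[of _ 0])
next
  case (add c k f)
  then obtain D where "((\<lambda>t. lp_eval f (w * cis t)) has_vector_derivative D) (at t)" by blast
  moreover have "((\<lambda>t. c * (w * cis t) powi k) has_vector_derivative
      c * w powi k * (of_int k * \<i> * exp (\<i> * of_int k * of_real t))) (at t)"
  proof -
    have eq: "(\<lambda>t. c * (w * cis t) powi k) = (\<lambda>t. c * w powi k * exp (\<i> * of_int k * of_real t))"
      by (simp add: power_int_mult_distrib cis_power_int) (simp add: cis_conv_exp mult_ac)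
    have "((\<lambda>x. c * w powi k * exp (\<i> * of_int k * x)) has_field_derivative
        c * w powi k * (of_int k * \<i> * exp (\<i> * of_int k * of_real t))) (at (of_real t))"
      by (auto intro!: derivative_eq_intros)
    from has_vector_derivative_real_field[OF this] show ?thesis unfolding eq .
  qed
  ultimately show ?case using add.hyps
    by (auto simp: lp_eval_add intro!: exI has_vector_derivative_add)
qed

section \<open>Unitary diagonalization of Hermitian matrices\<close>

lemma mat_adjoint_dim [simp]:
  "dim_row (mat_adjoint A) = dim_col A" "dim_col (mat_adjoint A) = dim_row A"
  by (simp_all add: mat_adjoint_def)

lemma mat_adjoint_carrier [simp]: "A \<in> carrier_mat n m \<Longrightarrow> mat_adjoint A \<in> carrier_mat m n"
  by (intro carrier_matI) auto

lemma mat_adjoint_index [simp]: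
  "i < dim_col A \<Longrightarrow> j < dim_row A \<Longrightarrow> mat_adjoint A $$ (i, j) = conjugate (A $$ (j, i))"
  by (simp add: mat_adjoint_def mat_of_rows_def)

lemma mat_adjoint_adjoint [simp]: "mat_adjoint (mat_adjoint A) = (A :: complex mat)"
  by (intro eq_matI) auto

lemma mat_adjoint_mult:
  fixes A B :: "complex mat"
  assumes "A \<in> carrier_mat n m" "B \<in> carrier_mat m k"
  shows "mat_adjoint (A * B) = mat_adjoint B * mat_adjoint A"
  using assms by (intro eq_matI) (auto simp: scalar_prod_def mult.commute)

text \<open>Gram-Schmidt applied to a basis that starts with \<open>v\<close> leaves
  \<open>v\<close> in place, so after normalizing the columns the first one is \<open>v\<close>
  divided by its norm.\<close>

lemma unitary_with_first_col:
  fixes v :: "complex vec"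
  assumes v: "v \<in> carrier_vec n" "v \<noteq> 0\<^sub>v n"
  obtains W c where "W \<in> carrier_mat n n" "mat_adjoint W * W = 1\<^sub>m n" "col W 0 = c \<cdot>\<^sub>v v"
proof -
  interpret cof_vec_space n "TYPE(complex)" .
  have n: "n > 0" using v by (cases n) auto
  define b where "b = basis_completion v"
  define ws where "ws = gram_schmidt n b"
  note b = basis_completion[OF v, folded b_def]
  have ws: "set ws \<subseteq> carrier_vec n" "corthogonal ws" "length ws = n"
    using gram_schmidt_result[OF b(2,4,5), of ws] b(6) by (simp_all add: ws_def)
  have hd: "hd ws = v"
    using b(6,7) n gram_schmidt_hd[OF v(1), of "tl b"] unfolding ws_def by (cases b) auto
  define N where "N j = sqrt (\<Sum>i<n. (cmod (ws ! j $ i))\<^sup>2)" for j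
  define W where "W = mat n n (\<lambda>(i, j). ws ! j $ i / of_real (N j))"
  have ws_carrier: "ws ! j \<in> carrier_vec n" if "j < n" for j
    using that ws(1,3) nth_mem by blast
  have orth: "(\<Sum>k<n. ws ! i $ k * cnj (ws ! j $ k)) = 0 \<longleftrightarrow> i \<noteq> j" if "i < n" "j < n" for i j
    using corthogonalD[OF ws(2), of i j] that ws(3) ws_carrier[of i] ws_carrier[of j]
    by (simp add: scalar_prod_def atLeast0LessThan)
  have N: "(\<Sum>k<n. ws ! j $ k * cnj (ws ! j $ k)) = of_real ((N j)\<^sup>2)" for j
  proof -
    have "(N j)\<^sup>2 = (\<Sum>i<n. (cmod (ws ! j $ i))\<^sup>2)" by (simp add: N_def sum_nonneg)
    then show ?thesis by (simp only: of_real_sum complex_norm_square)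
  qed
  have N0: "N j \<noteq> 0" if "j < n" for j
    using orth[OF that that] N[of j] by auto
  show ?thesis
  proof
    show W: "W \<in> carrier_mat n n" by (simp add: W_def)
    show "mat_adjoint W * W = 1\<^sub>m n"
    proof (intro eq_matI)
      fix i j assume "i < dim_row (1\<^sub>m n)" "j < dim_col (1\<^sub>m n)"
      then have ij: "i < n" "j < n" by auto
      have "(mat_adjoint W * W) $$ (i, j)
          = (\<Sum>k<n. cnj (ws ! i $ k) / of_real (N i) * (ws ! j $ k / of_real (N j)))"
        using ij by (simp add: W_def scalar_prod_def atLeast0LessThan)
      also have "\<dots> = (\<Sum>k<n. ws ! j $ k * cnj (ws ! i $ k)) / of_real (N i * N j)"
        by (simp add: sum_divide_distrib mult.commute)
      also have "\<dots> = 1\<^sub>m n $$ (i, j)"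
        using orth[OF ij(2,1)] N[of j] N0 ij by (auto simp: power2_eq_square)
      finally show "(mat_adjoint W * W) $$ (i, j) = 1\<^sub>m n $$ (i, j)" .
    qed (simp_all add: W_def)
    have "ws ! 0 = v" using hd ws(3) n by (metis hd_conv_nth length_0_conv less_numeral_extra(3))
    then show "col W 0 = inverse (of_real (N 0)) \<cdot>\<^sub>v v"
      using n v(1) by (intro eq_vecI) (auto simp: W_def field_simps)
  qed
qed

text \<open>The block diagonal matrix diag(a, M), by which the induction on the size passes from n
  to n + 1.\<close>

definition bordered :: "complex \<Rightarrow> complex mat \<Rightarrow> complex mat" where
  "bordered a M = mat (Suc (dim_row M)) (Suc (dim_col M)) (\<lambda>(i, j).
     if i = 0 \<and> j = 0 then a else if i = 0 \<or> j = 0 then 0 else M $$ (i - 1, j - 1))"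

lemma bordered_dim [simp]:
  "dim_row (bordered a M) = Suc (dim_row M)" "dim_col (bordered a M) = Suc (dim_col M)"
  by (simp_all add: bordered_def)

lemma bordered_carrier [simp]:
  "M \<in> carrier_mat n m \<Longrightarrow> bordered a M \<in> carrier_mat (Suc n) (Suc m)"
  by (intro carrier_matI) auto

lemma bordered_index [simp]:
  "bordered a M $$ (0, 0) = a"
  "i < dim_row M \<Longrightarrow> bordered a M $$ (Suc i, 0) = 0"
  "j < dim_col M \<Longrightarrow> bordered a M $$ (0, Suc j) = 0"
  "i < dim_row M \<Longrightarrow> j < dim_col M \<Longrightarrow> bordered a M $$ (Suc i, Suc j) = M $$ (i, j)"
  by (simp_all add: bordered_def)

lemma bordered_mult:
  assumes "M \<in> carrier_mat n m" "N \<in> carrier_mat m k"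
  shows "bordered a M * bordered b N = bordered (a * b) (M * N)"
proof (intro eq_matI)
  fix i j assume "i < dim_row (bordered (a * b) (M * N))" "j < dim_col (bordered (a * b) (M * N))"
  then show "(bordered a M * bordered b N) $$ (i, j) = bordered (a * b) (M * N) $$ (i, j)"
    using assms by (cases i; cases j)
      (auto simp: scalar_prod_def sum.atLeast0_lessThan_Suc_shift simp del: sum.op_ivl_Suc)
qed auto

lemma bordered_adjoint: "mat_adjoint (bordered a M) = bordered (cnj a) (mat_adjoint M)"
proof (intro eq_matI)
  fix i j assume "i < dim_row (bordered (cnj a) (mat_adjoint M))" "j < dim_col (bordered (cnj a) (mat_adjoint M))"
  then show "mat_adjoint (bordered a M) $$ (i, j) = bordered (cnj a) (mat_adjoint M) $$ (i, j)"
    by (cases i; cases j) auto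
qed auto

lemma bordered_one: "bordered 1 (1\<^sub>m n) = 1\<^sub>m (Suc n)"
proof (intro eq_matI)
  fix i j assume "i < dim_row (1\<^sub>m (Suc n))" "j < dim_col (1\<^sub>m (Suc n))"
  then show "bordered 1 (1\<^sub>m n) $$ (i, j) = 1\<^sub>m (Suc n) $$ (i, j)"
    by (cases i; cases j) auto
qed auto

definition rdiag :: "nat \<Rightarrow> (nat \<Rightarrow> real) \<Rightarrow> complex mat" where
  "rdiag n d = mat n n (\<lambda>(i, j). if i = j then of_real (d i) else 0)"

lemma rdiag_carrier [simp]: "rdiag n d \<in> carrier_mat n n"
  and rdiag_dim [simp]: "dim_row (rdiag n d) = n" "dim_col (rdiag n d) = n"
  by (simp_all add: rdiag_def)

lemma bordered_rdiag: "bordered (of_real a) (rdiag n d) = rdiag (Suc n) (case_nat a d)"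
proof (intro eq_matI)
  fix i j assume "i < dim_row (rdiag (Suc n) (case_nat a d))" "j < dim_col (rdiag (Suc n) (case_nat a d))"
  then show "bordered (of_real a) (rdiag n d) $$ (i, j) = rdiag (Suc n) (case_nat a d) $$ (i, j)"
    by (cases i; cases j) (auto simp: rdiag_def)
qed auto

lemma complex_mat_has_eigenvector:
  assumes "(H :: complex mat) \<in> carrier_mat n n" "n > 0"
  obtains v e where "v \<in> carrier_vec n" "v \<noteq> 0\<^sub>v n" "H *\<^sub>v v = e \<cdot>\<^sub>v v"
proof -
  obtain as where as: "char_poly H = (\<Prod>a\<leftarrow>as. [:- a, 1:])" "length as = n"
    using char_poly_factorized[OF assms(1)] by blast
  then obtain e as' where "as = e # as'" using assms(2) by (cases as) auto
  then have "poly (char_poly H) e = 0" by (simp add: as(1))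
  then have "eigenvalue H e" using eigenvalue_root_char_poly[OF assms(1)] by simp
  then show ?thesis using that assms(1) by (auto simp: eigenvalue_def eigenvector_def)
qed

text \<open>Deflation: conjugating by a unitary matrix whose first column is an eigenvector clears
  the first column below the diagonal, Hermitian symmetry clears the first row as well, and the
  induction hypothesis diagonalizes the remaining block.\<close>

theorem hermitian_unitary_diagonalization:
  fixes H :: "complex mat"
  assumes "H \<in> carrier_mat n n" "mat_adjoint H = H"
  shows "\<exists>W d. W \<in> carrier_mat n n \<and> mat_adjoint W * W = 1\<^sub>m n \<and>
           H = W * rdiag n d * mat_adjoint W"
  using assms
proof (induction n arbitrary: H)
  case 0
  then show ?case by (intro exI[of _ "1\<^sub>m 0"] exI) auto
next
  case (Suc n)
  note H = Suc.prems(1)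
  obtain v e where v: "v \<in> carrier_vec (Suc n)" "v \<noteq> 0\<^sub>v (Suc n)" "H *\<^sub>v v = e \<cdot>\<^sub>v v"
    using complex_mat_has_eigenvector[OF H] by blast
  obtain W c where W: "W \<in> carrier_mat (Suc n) (Suc n)" "mat_adjoint W * W = 1\<^sub>m (Suc n)"
    "col W 0 = c \<cdot>\<^sub>v v"
    using unitary_with_first_col[OF v(1,2)] by blast
  note W' = mat_adjoint_carrier[OF W(1)]
  have WW': "W * mat_adjoint W = 1\<^sub>m (Suc n)"
    by (rule mat_mult_left_right_inverse[OF W' W(1,2)])
  define K where "K = mat_adjoint W * H * W"
  have K: "K \<in> carrier_mat (Suc n) (Suc n)" using H W(1) W' unfolding K_def by (intro mult_carrier_mat)
  have HK: "H = W * K * mat_adjoint W"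
  proof -
    define X where "X = mat_adjoint W * H"
    have X: "X \<in> carrier_mat (Suc n) (Suc n)" using W' H unfolding X_def by (rule mult_carrier_mat)
    note ass = assoc_mult_mat[of _ "Suc n" "Suc n" _ "Suc n" _ "Suc n"]
    have "W * K * mat_adjoint W = (W * X) * (W * mat_adjoint W)"
      using X W(1) W' by (simp add: K_def ass flip: X_def)
    also have "W * X = (W * mat_adjoint W) * H"
      using H W(1) W' by (simp add: X_def ass)
    finally have "W * K * mat_adjoint W = (W * mat_adjoint W) * H * (W * mat_adjoint W)" .
    then show ?thesis using H by (simp add: WW')
  qed
  have K_adj: "mat_adjoint K = K"
    using H W(1) W' Suc.prems(2)
    by (simp add: K_def mat_adjoint_mult[of _ "Suc n" "Suc n" _ "Suc n"] assoc_mult_mat[of _ "Suc n" "Suc n" _ "Suc n" _ "Suc n"])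
  have cW: "col W 0 \<in> carrier_vec (Suc n)" using W(1) by (intro carrier_vecI) simp
  have "col K 0 = (mat_adjoint W * H) *\<^sub>v col W 0"
    using W(1) by (simp add: K_def col_mult2[OF mult_carrier_mat[OF W' H] W(1)])
  also have "\<dots> = mat_adjoint W *\<^sub>v (H *\<^sub>v col W 0)"
    by (rule assoc_mult_mat_vec[OF W' H cW])
  also have "H *\<^sub>v col W 0 = e \<cdot>\<^sub>v col W 0"
    using v(3) by (simp add: W(3) mult_mat_vec[OF H v(1)] smult_smult_assoc mult.commute)
  also have "mat_adjoint W *\<^sub>v (e \<cdot>\<^sub>v col W 0) = e \<cdot>\<^sub>v (mat_adjoint W *\<^sub>v col W 0)"
    by (rule mult_mat_vec[OF W' cW])
  also have "mat_adjoint W *\<^sub>v col W 0 = col (mat_adjoint W * W) 0"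
    by (simp add: col_mult2[OF W' W(1)])
  also have "\<dots> = unit_vec (Suc n) 0" by (simp add: W(2))
  finally have K0: "col K 0 = e \<cdot>\<^sub>v unit_vec (Suc n) 0" .
  have K_col: "K $$ (Suc i, 0) = 0" if "i < n" for i
    using arg_cong[OF K0, of "\<lambda>v. v $ Suc i"] that K by simp
  \<comment> \<open>The symmetry does two things: it carries the zeros of the first column over to
    the first row, and it makes the corner entry real.\<close>
  have K_sym: "K $$ (i, j) = cnj (K $$ (j, i))" if "i < Suc n" "j < Suc n" for i j
    using arg_cong[OF K_adj, of "\<lambda>M. M $$ (i, j)"] that K by simp
  define a where "a = Re (K $$ (0, 0))"
  have a: "K $$ (0, 0) = of_real a"
    using K_sym[of 0 0] by (simp add: a_def complex_eq_iff)
  define L where "L = mat n n (\<lambda>(i, j). K $$ (Suc i, Suc j))"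
  have L: "L \<in> carrier_mat n n" by (simp add: L_def)
  have KL: "K = bordered (of_real a) L"
  proof (intro eq_matI)
    fix i j assume "i < dim_row (bordered (of_real a) L)" "j < dim_col (bordered (of_real a) L)"
    then show "K $$ (i, j) = bordered (of_real a) L $$ (i, j)"
      using K_col K_sym[of 0 j] by (cases i; cases j) (auto simp: a L_def)
  qed (use K L in auto)
  have "mat_adjoint L = L"
    by (intro eq_matI) (auto simp: L_def intro!: K_sym[symmetric])
  from Suc.IH[OF L this] obtain V d where V: "V \<in> carrier_mat n n"
    "mat_adjoint V * V = 1\<^sub>m n" "L = V * rdiag n d * mat_adjoint V" by blast
  let ?V = "bordered 1 V" and ?D = "rdiag (Suc n) (case_nat a d)"
  note V' = mat_adjoint_carrier[OF V(1)]
  have bV: "?V \<in> carrier_mat (Suc n) (Suc n)" using V(1) by simp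
  have bV': "mat_adjoint ?V = bordered 1 (mat_adjoint V)" by (simp add: bordered_adjoint)
  have VV: "mat_adjoint ?V * ?V = 1\<^sub>m (Suc n)"
    by (simp add: bV' bordered_mult[OF V' V(1)] V(2) bordered_one)
  have KV: "K = ?V * ?D * mat_adjoint ?V"
    unfolding KL V(3) bV'
    by (simp add: bordered_mult[OF V(1) rdiag_carrier] bordered_mult[OF mult_carrier_mat[OF V(1) rdiag_carrier] V']
        flip: bordered_rdiag)
  note adjm = mat_adjoint_mult[OF W(1) bV]
  note ass = assoc_mult_mat[of _ "Suc n" "Suc n" _ "Suc n" _ "Suc n"]
  note mc = mult_carrier_mat[of _ "Suc n" "Suc n" _ "Suc n"]
  have "mat_adjoint (W * ?V) * (W * ?V) = mat_adjoint ?V * (mat_adjoint W * W) * ?V"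
    using W(1) W' bV mat_adjoint_carrier[OF bV] by (simp add: adjm ass mc)
  also have "\<dots> = 1\<^sub>m (Suc n)"
    by (simp only: W(2) right_mult_one_mat[OF mat_adjoint_carrier[OF bV]] VV)
  finally have "mat_adjoint (W * ?V) * (W * ?V) = 1\<^sub>m (Suc n)" .
  moreover have "H = (W * ?V) * ?D * mat_adjoint (W * ?V)"
    unfolding HK KV adjm using W(1) W' bV mat_adjoint_carrier[OF bV] by (simp add: ass mc)
  moreover have "W * ?V \<in> carrier_mat (Suc n) (Suc n)" by (rule mult_carrier_mat[OF W(1) bV])
  ultimately show ?case by blast
qed

section \<open>Counting eigenvalue signs with multiplicity\<close>

lemma order_prod_linear:
  fixes n :: nat
  shows "order x (\<Prod>i<n. [:- f i, 1:]) = card {i. i < n \<and> f i = (x :: complex)}"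
proof (induction n)
  case (Suc n)
  have nz: "(\<Prod>i<n. [:- f i, 1:]) \<noteq> 0" by (simp add: prod_zero_iff)
  have "order x [:- f n, 1:] = (if f n = x then 1 else 0)"
    using order_power_n_n[of "f n" 1] by (auto intro: order_0I)
  moreover have "{i. i < Suc n \<and> f i = x} = (if f n = x then insert n {i. i < n \<and> f i = x} else {i. i < n \<and> f i = x})"
    by (auto simp: less_Suc_eq)
  ultimately show ?case using Suc nz by (simp add: order_mult del: mult_pCons_left mult_pCons_right)
qed simp

text \<open>The multiplicity of a root is the number of indices whose \<open>d i\<close> equals it,
  so summing over roots regroups the indices by value. The predicate \<open>P\<close> serves both
  signs at once.\<close>

lemma sum_order_real_roots:
  fixes d :: "nat \<Rightarrow> real" and n :: nat
  defines "p \<equiv> (\<Prod>i<n. [:- complex_of_real (d i), 1:])"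
  shows "(\<Sum>x\<in>{x. poly p x = 0 \<and> Im x = 0 \<and> P (Re x)}. order x p) = card {i. i < n \<and> P (d i)}"
proof -
  let ?S = "{x. poly p x = 0 \<and> Im x = 0 \<and> P (Re x)}" and ?I = "{i. i < n \<and> P (d i)}"
  have "p \<noteq> 0" by (simp add: p_def prod_zero_iff)
  then have fin: "finite ?S" using poly_roots_finite[of p] by (rule_tac finite_subset[rotated]) auto
  have "order x p = card {i \<in> ?I. complex_of_real (d i) = x}" if "x \<in> ?S" for x
    using that unfolding p_def order_prod_linear by (intro arg_cong[of _ _ card]) auto
  then have "(\<Sum>x\<in>?S. order x p) = (\<Sum>x\<in>?S. sum (\<lambda>_. 1) {i \<in> ?I. complex_of_real (d i) = x})"
    by (intro sum.cong) auto
  also have "\<dots> = sum (\<lambda>_. 1) ?I"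
    by (intro sum.group fin) (auto simp: p_def poly_prod)
  finally show ?thesis by simp
qed

text \<open>\<open>w i\<close> is column i of the diagonalizing unitary matrix. Unitarity makes the
  matrix similar to its diagonal form, which transfers the characteristic polynomial, hence
  \<open>nu_pos\<close> and \<open>nu_neg\<close>, and the determinant.\<close>

theorem hermitian_spectral_form:
  fixes H :: "complex mat"
  assumes H: "H \<in> carrier_mat n n" and herm: "\<And>j k. j < n \<Longrightarrow> k < n \<Longrightarrow> H $$ (j, k) = cnj (H $$ (k, j))"
  obtains w :: "nat \<Rightarrow> nat \<Rightarrow> complex" and d :: "nat \<Rightarrow> real" where
    "\<And>j k. j < n \<Longrightarrow> k < n \<Longrightarrow> H $$ (j, k) = (\<Sum>i<n. of_real (d i) * w i j * cnj (w i k))"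
    "nu_pos H = card {i. i < n \<and> d i > 0}" "nu_neg H = card {i. i < n \<and> d i < 0}"
    "det H = (\<Prod>i<n. of_real (d i))"
proof -
  have "mat_adjoint H = H"
    using H by (intro eq_matI) (auto intro!: herm[symmetric])
  then obtain W d where W: "W \<in> carrier_mat n n" "mat_adjoint W * W = 1\<^sub>m n"
      "H = W * rdiag n d * mat_adjoint W"
    using hermitian_unitary_diagonalization[OF H] by blast
  have W': "mat_adjoint W \<in> carrier_mat n n" using W(1) by simp
  have "similar_mat H (rdiag n d)"
    unfolding similar_mat_def
    by (rule exI[of _ W], rule exI[of _ "mat_adjoint W"], rule similar_mat_witI[of _ _ n])
       (use H W W' mat_mult_left_right_inverse[OF W' W(1,2)] in auto)
  then have cp: "char_poly H = char_poly (rdiag n d)" and det: "det H = det (rdiag n d)"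
    by (simp_all add: char_poly_similar det_similar)
  have ut: "upper_triangular (rdiag n d)"
    by (auto simp: upper_triangular_def rdiag_def)
  have diag: "diag_mat (rdiag n d) = map (\<lambda>i. of_real (d i)) [0..<n]"
    by (simp add: diag_mat_def rdiag_def)
  have cp: "char_poly H = (\<Prod>i<n. [:- complex_of_real (d i), 1:])"
    unfolding cp char_poly_upper_triangular[OF rdiag_carrier ut] diag
    by (simp add: o_def prod.distinct_set_conv_list[symmetric] atLeast0LessThan)
  show ?thesis
  proof
    show "H $$ (j, k) = (\<Sum>i<n. of_real (d i) * W $$ (j, i) * cnj (W $$ (k, i)))"
      if "j < n" "k < n" for j k
    proof -
      have "(W * rdiag n d) $$ (j, i) = W $$ (j, i) * of_real (d i)" if "i < n" for i
        using W(1) \<open>j < n\<close> that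
        by (simp add: scalar_prod_def rdiag_def if_distrib[of "\<lambda>x. _ * x"] sum.delta cong: if_cong)
      then show ?thesis
        using W(1) that unfolding W(3)
        by (subst index_mult_mat) (auto simp: scalar_prod_def atLeast0LessThan mult_ac intro!: sum.cong)
    qed
    show "nu_pos H = card {i. i < n \<and> d i > 0}" "nu_neg H = card {i. i < n \<and> d i < 0}"
      unfolding nu_pos_def nu_neg_def cp by (rule sum_order_real_roots)+
    show "det H = (\<Prod>i<n. of_real (d i))"
      unfolding det det_upper_triangular[OF ut rdiag_carrier] diag
      by (simp add: prod.distinct_set_conv_list[symmetric] atLeast0LessThan)
  qed
qed

section \<open>Perturbation of Hermitian forms\<close>

text \<open>This is x^* M x. Matrices and vectors are plain functions of indices here, so that
  limits and derivatives can be taken entry by entry.\<close>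

definition qform :: "nat \<Rightarrow> (nat \<Rightarrow> nat \<Rightarrow> complex) \<Rightarrow> (nat \<Rightarrow> complex) \<Rightarrow> complex" where
  "qform n M x = (\<Sum>j<n. \<Sum>k<n. cnj (x j) * M j k * x k)"

definition spectral_form ::
  "nat \<Rightarrow> (nat \<Rightarrow> nat \<Rightarrow> complex) \<Rightarrow> (nat \<Rightarrow> nat \<Rightarrow> complex) \<Rightarrow> (nat \<Rightarrow> real) \<Rightarrow> bool" where
  "spectral_form n M w d \<longleftrightarrow>
     (\<forall>j<n. \<forall>k<n. M j k = (\<Sum>i<n. of_real (d i) * w i j * cnj (w i k)))"

lemma spectral_form_uminus:
  "spectral_form n M w d \<Longrightarrow> spectral_form n (\<lambda>j k. - M j k) w (\<lambda>i. - d i)"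
  by (simp add: spectral_form_def sum_negf)

lemma spectral_form_apply:
  assumes "spectral_form n M w d" "j < n"
  shows "(\<Sum>k<n. M j k * x k) = (\<Sum>i<n. of_real (d i) * w i j * (\<Sum>k<n. cnj (w i k) * x k))"
proof -
  have "(\<Sum>k<n. M j k * x k) = (\<Sum>k<n. \<Sum>i<n. of_real (d i) * w i j * (cnj (w i k) * x k))"
    using assms by (intro sum.cong refl) (simp add: spectral_form_def sum_distrib_right mult.assoc)
  also have "\<dots> = (\<Sum>i<n. of_real (d i) * w i j * (\<Sum>k<n. cnj (w i k) * x k))"
    by (subst sum.swap) (simp add: sum_distrib_left)
  finally show ?thesis .
qed

lemma qform_alt: "qform n M x = (\<Sum>j<n. cnj (x j) * (\<Sum>k<n. M j k * x k))"
  by (simp add: qform_def sum_distrib_left mult.assoc)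

text \<open>In the coordinates given by pairing \<open>x\<close> with the \<open>w i\<close> the
  form is diagonal with weights \<open>d i\<close>. Once the coordinates with weights of one sign
  vanish, the sign of the form is visible.\<close>

lemma qform_spectral:
  assumes "spectral_form n M w d"
  shows "qform n M x = of_real (\<Sum>i<n. d i * (cmod (\<Sum>k<n. cnj (w i k) * x k))\<^sup>2)"
proof -
  define c where "c i = (\<Sum>k<n. cnj (w i k) * x k)" for i
  have "qform n M x = (\<Sum>j<n. \<Sum>i<n. of_real (d i) * (cnj (x j) * w i j) * c i)"
    unfolding qform_alt using spectral_form_apply[OF assms, of _ x, folded c_def]
    by (intro sum.cong refl) (simp add: sum_distrib_left mult_ac)
  also have "\<dots> = (\<Sum>i<n. of_real (d i) * (\<Sum>j<n. cnj (x j) * w i j) * c i)"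
    by (subst sum.swap) (simp add: sum_distrib_left sum_distrib_right)
  also have "\<dots> = (\<Sum>i<n. of_real (d i * (cmod (c i))\<^sup>2))"
  proof (intro sum.cong refl)
    fix i
    have "(\<Sum>j<n. cnj (x j) * w i j) = cnj (c i)" by (simp add: c_def mult.commute)
    then show "of_real (d i) * (\<Sum>j<n. cnj (x j) * w i j) * c i = of_real (d i * (cmod (c i))\<^sup>2)"
      by (simp only: of_real_mult complex_norm_square mult.assoc mult.commute[of "c i"])
  qed
  finally show ?thesis by (simp add: c_def)
qed

lemma qform_diff: "qform n (\<lambda>j k. M j k - N j k) x = qform n M x - qform n N x"
  by (simp add: qform_def sum_subtractf algebra_simps)

lemma qform_uminus: "qform n (\<lambda>j k. - M j k) x = - qform n M x"
  by (simp add: qform_def sum_negf)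

lemma qform_scale: "qform n M (\<lambda>k. of_real r * x k) = of_real (r\<^sup>2) * qform n M x"
  by (simp add: qform_def sum_distrib_left power2_eq_square mult_ac)

lemma qform_mult: "qform n (\<lambda>j k. c * M j k) x = c * qform n M x"
  by (simp add: qform_def sum_distrib_left mult_ac)

lemma qform_cong:
  "(\<And>j k. j < n \<Longrightarrow> k < n \<Longrightarrow> M j k = N j k) \<Longrightarrow> (\<And>k. k < n \<Longrightarrow> x k = y k) \<Longrightarrow>
    qform n M x = qform n N y"
  by (simp add: qform_def)

section \<open>Dimension count for definite forms\<close>

lemma underdetermined_system:
  fixes a :: "'i \<Rightarrow> nat \<Rightarrow> complex"
  assumes "finite I" "card I < n"
  obtains x where "\<exists>k<n. x k \<noteq> 0" "\<And>i. i \<in> I \<Longrightarrow> (\<Sum>k<n. a i k * x k) = 0"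
proof -
  obtain e where e: "bij_betw e {0..<card I} I"
    using ex_bij_betw_nat_finite[OF assms(1)] by blast
  \<comment> \<open>Zero rows pad the system to a square one. Row \<open>card I\<close> exists
    because \<open>card I < n\<close>, and it kills every product in the Leibniz formula.\<close>
  define M where "M = mat n n (\<lambda>(r, k). if r < card I then a (e r) k else 0)"
  have M: "M \<in> carrier_mat n n" by (simp add: M_def)
  have zero: "(\<Prod>i = 0..<n. M $$ (i, p i)) = 0" if "p permutes {0..<n}" for p
    using assms(2) permutes_in_image[OF that, of "card I"]
    by (intro prod_zero bexI[of _ "card I"]) (auto simp: M_def)
  have "det M = 0"
    unfolding det_def'[OF M] by (intro sum.neutral ballI) (simp only: zero mem_Collect_eq mult_zero_right)
  then obtain v where v: "v \<in> carrier_vec n" "v \<noteq> 0\<^sub>v n" "M *\<^sub>v v = 0\<^sub>v n"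
    using det_0_iff_vec_prod_zero[OF M] by blast
  show ?thesis
  proof
    show "\<exists>k<n. v $ k \<noteq> 0" using v(1,2) by (metis carrier_vecD eq_vecI index_zero_vec)
    fix i assume "i \<in> I"
    then obtain r where r: "r < card I" "e r = i"
      using e by (metis bij_betw_imp_surj_on imageE atLeastLessThan_iff)
    then have "(M *\<^sub>v v) $ r = (\<Sum>k<n. a i k * v $ k)"
      using assms(2) v(1) by (simp add: M_def scalar_prod_def atLeast0LessThan)
    then show "(\<Sum>k<n. a i k * v $ k) = 0" using v(3) r assms(2) by simp
  qed
qed

text \<open>Half of Sylvester's law of inertia. If too many weights were nonpositive, the equations
  from \<open>I\<close> and those killing the coordinates of positive weight would number fewer than
  n; a common nonzero solution would make the form both positive and nonpositive.\<close>

lemma card_nonpos_le_codim: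
  assumes spec: "spectral_form n M w d" and "finite I"
    and pos: "\<And>x. \<exists>k<n. x k \<noteq> 0 \<Longrightarrow> \<forall>i\<in>I. (\<Sum>k<n. a i k * x k) = 0 \<Longrightarrow> Re (qform n M x) > 0"
  shows "card {i. i < n \<and> d i \<le> 0} \<le> card I"
proof (rule ccontr)
  assume less: "\<not> ?thesis"
  let ?J = "{i. i < n \<and> d i > 0}"
  have "{..<n} = {i. i < n \<and> d i \<le> 0} \<union> ?J" by auto
  then have "n = card {i. i < n \<and> d i \<le> 0} + card ?J"
    by (metis (no_types, lifting) card_Un_disjoint card_lessThan disjoint_iff finite_Un finite_lessThan
        mem_Collect_eq not_less)
  then have "card (I <+> ?J) < n" using less \<open>finite I\<close> by (simp add: card_Plus)
  then obtain x where x: "\<exists>k<n. x k \<noteq> 0"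
      "\<And>i. i \<in> I <+> ?J \<Longrightarrow> (\<Sum>k<n. (case i of Inl i \<Rightarrow> a i k | Inr i \<Rightarrow> cnj (w i k)) * x k) = 0"
    using underdetermined_system[of "I <+> ?J" n "\<lambda>i k. case i of Inl i \<Rightarrow> a i k | Inr i \<Rightarrow> cnj (w i k)"] \<open>finite I\<close>
    by auto
  have "\<forall>i\<in>I. (\<Sum>k<n. a i k * x k) = 0" using x(2)[OF InlI] by auto
  then have "Re (qform n M x) > 0" by (intro pos x(1))
  moreover have "d i * (cmod (\<Sum>k<n. cnj (w i k) * x k))\<^sup>2 \<le> 0" if "i < n" for i
    using x(2)[OF InrI, of i] that by (cases "d i > 0") (auto intro: mult_nonpos_nonneg)
  then have "Re (qform n M x) \<le> 0"
    unfolding qform_spectral[OF spec] by (auto intro: sum_nonpos)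
  ultimately show False by simp
qed

section \<open>Compactness and first-order perturbation\<close>

lemma convergent_subsequence_finite:
  fixes x :: "nat \<Rightarrow> nat \<Rightarrow> complex"
  assumes "\<And>m k. k < n \<Longrightarrow> cmod (x m k) \<le> B"
  shows "\<exists>r l. strict_mono r \<and> (\<forall>k<n. (\<lambda>m. x (r m) k) \<longlonglongrightarrow> l k)"
  using assms
proof (induction n)
  case 0
  then show ?case by (intro exI[of _ id]) (auto simp: strict_mono_def)
next
  case (Suc n)
  then obtain r l where r: "strict_mono r" "\<forall>k<n. (\<lambda>m. x (r m) k) \<longlonglongrightarrow> l k"
    by (metis less_Suc_eq)
  have "bounded (range (\<lambda>m. x (r m) n))"
    using Suc.prems[of n] by (auto simp: bounded_iff)
  then obtain l' s where s: "strict_mono s" "((\<lambda>m. x (r m) n) \<circ> s) \<longlonglongrightarrow> l'"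
    using bounded_imp_convergent_subsequence by blast
  have "(\<lambda>m. x ((r \<circ> s) m) k) \<longlonglongrightarrow> (l(n := l')) k" if "k < Suc n" for k
    using that r(2) s LIMSEQ_subseq_LIMSEQ[of "\<lambda>m. x (r m) k" "l k" s]
    by (cases "k = n") (auto simp: o_def less_Suc_eq)
  then show ?case using strict_mono_o[OF r(1) s(1)] by blast
qed

lemma tendsto_qform:
  assumes "\<And>j k. j < n \<Longrightarrow> k < n \<Longrightarrow> ((\<lambda>m. M m j k) \<longlongrightarrow> N j k) F"
    and "\<And>k. k < n \<Longrightarrow> ((\<lambda>m. x m k) \<longlongrightarrow> l k) F"
  shows "((\<lambda>m. qform n (M m) (x m)) \<longlongrightarrow> qform n N l) F"
  unfolding qform_def using assms by (intro tendsto_intros) auto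

lemma normalize_vector:
  fixes x :: "nat \<Rightarrow> complex"
  assumes "\<exists>k<n. x k \<noteq> 0"
  obtains r :: real where "r > 0" "(\<Sum>k<n. (cmod (of_real r * x k))\<^sup>2) = 1"
proof -
  let ?S = "\<Sum>k<n. (cmod (x k))\<^sup>2"
  have "?S > 0" using assms by (auto intro!: sum_pos2)
  then have "(\<Sum>k<n. (cmod (of_real (1 / sqrt ?S) * x k))\<^sup>2) = 1"
    by (simp add: norm_mult norm_divide power_mult_distrib power_divide flip: sum_divide_distrib)
  with \<open>?S > 0\<close> show ?thesis by (intro that[of "1 / sqrt ?S"]) auto
qed

text \<open>To first order in \<open>t\<close> the form of \<open>H t\<close> is that of \<open>H 0\<close> off the kernel and \<open>t\<close> times that of \<open>H'\<close> on it.\<close>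

lemma perturbation_positive:
  fixes H :: "real \<Rightarrow> nat \<Rightarrow> nat \<Rightarrow> complex"
  assumes deriv: "\<And>j k. j < n \<Longrightarrow> k < n \<Longrightarrow> ((\<lambda>t. H t j k) has_vector_derivative H' j k) (at 0)"
    and spec: "spectral_form n (H 0) w d"
    and pos: "\<And>x. \<exists>k<n. x k \<noteq> 0 \<Longrightarrow> \<forall>j<n. (\<Sum>k<n. H 0 j k * x k) = 0 \<Longrightarrow> Re (qform n H' x) > 0"
  shows "\<forall>\<^sub>F t in at_right 0. \<forall>x. (\<exists>k<n. x k \<noteq> 0) \<longrightarrow>
           (\<forall>i\<in>{i. i < n \<and> d i < 0}. (\<Sum>k<n. cnj (w i k) * x k) = 0) \<longrightarrow> Re (qform n (H t) x) > 0"
proof (rule ccontr)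
  define V where "V x \<longleftrightarrow> (\<forall>i\<in>{i. i < n \<and> d i < 0}. (\<Sum>k<n. cnj (w i k) * x k) = 0)" for x
  assume neg: "\<not> ?thesis"
  \<comment> \<open>Failure of the claim yields bad vectors for parameters tending to 0. As the form
    scales quadratically they can be taken of unit length, which keeps the limit of a subsequence
    away from 0.\<close>
  have ex: "\<exists>t x. 0 < t \<and> t < 1 / real (Suc m) \<and> (\<Sum>k<n. (cmod (x k))\<^sup>2) = 1 \<and> V x \<and> Re (qform n (H t) x) \<le> 0" for m
  proof -
    have "\<exists>t\<in>{0<..<1 / real (Suc m)}. \<exists>x. (\<exists>k<n. x k \<noteq> 0) \<and> V x \<and> \<not> Re (qform n (H t) x) > 0"
    proof (rule ccontr)
      assume "\<not> ?thesis"
      then have "\<forall>t>0. t < 1 / real (Suc m) \<longrightarrow> (\<forall>x. (\<exists>k<n. x k \<noteq> 0) \<longrightarrow> V x \<longrightarrow> Re (qform n (H t) x) > 0)"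
        by (meson greaterThanLessThan_iff)
      then have "\<forall>\<^sub>F t in at_right 0. \<forall>x. (\<exists>k<n. x k \<noteq> 0) \<longrightarrow> V x \<longrightarrow> Re (qform n (H t) x) > 0"
        unfolding eventually_at_right_field by (intro exI[of _ "1 / real (Suc m)"]) auto
      then show False using neg unfolding V_def by blast
    qed
    then obtain t x where tx: "0 < t" "t < 1 / real (Suc m)" "\<exists>k<n. x k \<noteq> 0" "V x" "\<not> Re (qform n (H t) x) > 0"
      by (metis greaterThanLessThan_iff)
    obtain r where r: "r > 0" "(\<Sum>k<n. (cmod (of_real r * x k))\<^sup>2) = 1"
      using normalize_vector[OF tx(3)] by blast
    have "(\<Sum>k<n. cnj (w i k) * (of_real r * x k)) = of_real r * (\<Sum>k<n. cnj (w i k) * x k)" for i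
      by (simp add: sum_distrib_left mult_ac)
    then have "V (\<lambda>k. of_real r * x k)" using tx(4) by (simp add: V_def)
    moreover have "Re (qform n (H t) (\<lambda>k. of_real r * x k)) \<le> 0"
      using tx(5) by (simp add: qform_scale mult_nonneg_nonpos del: of_real_power)
    ultimately show ?thesis using tx(1,2) r(2)
      by (intro exI[of _ t] exI[of _ "\<lambda>k. of_real r * x k"] conjI)
  qed
  then obtain t x where tx: "\<And>m. 0 < t m" "\<And>m. t m < 1 / real (Suc m)"
      "\<And>m. (\<Sum>k<n. (cmod (x m k))\<^sup>2) = 1" "\<And>m. V (x m)" "\<And>m. Re (qform n (H (t m)) (x m)) \<le> 0"
    by metis
  have "cmod (x m k) \<le> 1" if "k < n" for m k
  proof -
    have "(cmod (x m k))\<^sup>2 \<le> 1"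
      unfolding tx(3)[of m, symmetric] using that by (intro member_le_sum) auto
    then show ?thesis by (simp add: power_le_one_iff abs_square_le_1)
  qed
  then obtain r l where r: "strict_mono r" "\<And>k. k < n \<Longrightarrow> (\<lambda>m. x (r m) k) \<longlonglongrightarrow> l k"
    using convergent_subsequence_finite[of n x 1] by blast
  have "t \<longlonglongrightarrow> 0"
    using tx(1,2) less_imp_le
    by (intro real_tendsto_sandwich[OF _ _ tendsto_const LIMSEQ_inverse_real_of_nat])
       (auto simp: inverse_eq_divide intro!: always_eventually)
  then have "(\<lambda>m. t (r m)) \<longlonglongrightarrow> 0" using LIMSEQ_subseq_LIMSEQ[OF _ r(1)] by (auto simp: o_def)
  then have tr: "filterlim (\<lambda>m. t (r m)) (at 0) sequentially"
    using tx(1) by (auto simp: filterlim_at less_imp_neq[symmetric] intro!: always_eventually)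
  have quot: "((\<lambda>t. (H t j k - H 0 j k) /\<^sub>R t) \<longlongrightarrow> H' j k) (at 0)" if "j < n" "k < n" for j k
  proof -
    have "((\<lambda>t. (1 / \<bar>t\<bar>) *\<^sub>R (H t j k - (H 0 j k + t *\<^sub>R H' j k))) \<longlongrightarrow> 0) (at 0)"
      using deriv[OF that] unfolding has_vector_derivative_def has_derivative_at2 by simp
    from tendsto_norm_zero[OF this]
    have "((\<lambda>t. norm (H t j k - (H 0 j k + t *\<^sub>R H' j k)) / norm t) \<longlongrightarrow> 0) (at 0)"
      by simp
    moreover have "norm (H t j k - (H 0 j k + t *\<^sub>R H' j k)) / norm t
        = dist ((H t j k - H 0 j k) /\<^sub>R t) (H' j k)" if "t \<noteq> 0" for t
    proof -
      have "(H t j k - H 0 j k) /\<^sub>R t - H' j k = (H t j k - (H 0 j k + t *\<^sub>R H' j k)) /\<^sub>R t"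
        using that by (simp add: algebra_simps)
      then show ?thesis by (simp add: dist_norm divide_inverse_commute)
    qed
    ultimately have "((\<lambda>t. dist ((H t j k - H 0 j k) /\<^sub>R t) (H' j k)) \<longlongrightarrow> 0) (at 0)"
      by (elim Lim_transform_eventually) (simp add: eventually_at_filter)
    then show ?thesis by (subst tendsto_dist_iff)
  qed
  have cont: "((\<lambda>t. H t j k) \<longlongrightarrow> H 0 j k) (at 0)" if "j < n" "k < n" for j k
    using has_vector_derivative_continuous[OF deriv[OF that]] by (simp add: continuous_within)
  have "(\<lambda>m. \<Sum>k<n. (cmod (x (r m) k))\<^sup>2) \<longlonglongrightarrow> (\<Sum>k<n. (cmod (l k))\<^sup>2)"
    using r(2) by (intro tendsto_intros) auto
  then have "(\<Sum>k<n. (cmod (l k))\<^sup>2) = 1" using LIMSEQ_unique[OF tendsto_const] unfolding tx(3) by metis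
  then have l_nz: "\<exists>k<n. l k \<noteq> 0" by (rule_tac ccontr) auto
  have l_V: "V l" unfolding V_def
  proof
    fix i assume i: "i \<in> {i. i < n \<and> d i < 0}"
    have "(\<lambda>m. \<Sum>k<n. cnj (w i k) * x (r m) k) \<longlonglongrightarrow> (\<Sum>k<n. cnj (w i k) * l k)"
      using r(2) by (intro tendsto_intros) auto
    moreover have "(\<Sum>k<n. cnj (w i k) * x (r m) k) = 0" for m
      using tx(4) i by (auto simp: V_def)
    ultimately show "(\<Sum>k<n. cnj (w i k) * l k) = 0" by (simp add: LIMSEQ_const_iff)
  qed
  have nonneg: "d i * (cmod (\<Sum>k<n. cnj (w i k) * y k))\<^sup>2 \<ge> 0" if "V y" "i < n" for y i
    using that by (cases "d i < 0") (auto simp: V_def)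
  have "(\<lambda>m. Re (qform n (H (t (r m))) (x (r m)))) \<longlonglongrightarrow> Re (qform n (H 0) l)"
    using r(2) filterlim_compose[OF cont tr] by (intro tendsto_Re tendsto_qform) auto
  then have "Re (qform n (H 0) l) \<le> 0"
    by (rule LIMSEQ_le_const2) (use tx(5) in auto)
  \<comment> \<open>On \<open>V\<close> no term of the diagonal form of \<open>H 0\<close> is
    negative, while the limit gives a sum at most 0. So every term vanishes, and this puts
    \<open>l\<close> into the kernel of \<open>H 0\<close>.\<close>
  then have "(\<Sum>i<n. d i * (cmod (\<Sum>k<n. cnj (w i k) * l k))\<^sup>2) = 0"
    unfolding qform_spectral[OF spec] using nonneg[OF l_V] by (intro antisym) (auto intro: sum_nonneg)
  then have "\<forall>i<n. d i * (cmod (\<Sum>k<n. cnj (w i k) * l k))\<^sup>2 = 0"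
    using nonneg[OF l_V] by (subst (asm) sum_nonneg_eq_0_iff) auto
  then have "(\<Sum>k<n. H 0 j k * l k) = 0" if "j < n" for j
    unfolding spectral_form_apply[OF spec that] by (intro sum.neutral) auto
  then have "Re (qform n H' l) > 0" using pos l_nz by blast
  moreover have "Re (qform n H' l) \<le> 0"
  proof (rule LIMSEQ_le_const2)
    show "(\<lambda>m. Re (qform n (\<lambda>j k. (H (t (r m)) j k - H 0 j k) /\<^sub>R t (r m)) (x (r m)))) \<longlonglongrightarrow> Re (qform n H' l)"
      using r(2) filterlim_compose[OF quot tr] by (intro tendsto_Re tendsto_qform) auto
    \<comment> \<open>Subtracting the form of \<open>H 0\<close>, which is nonnegative on
      \<open>V\<close>, from a nonpositive number and dividing by a positive parameter keeps it
      nonpositive. In the limit this contradicts positivity of \<open>H'\<close> at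
      \<open>l\<close>.\<close>
    have "Re (qform n (\<lambda>j k. (H (t m) j k - H 0 j k) /\<^sub>R t m) (x m)) \<le> 0" for m
    proof -
      have "Re (qform n (H 0) (x m)) \<ge> 0"
        unfolding qform_spectral[OF spec] using nonneg[OF tx(4)] by (auto intro: sum_nonneg)
      then have "Re (qform n (H (t m)) (x m)) - Re (qform n (H 0) (x m)) \<le> 0"
        using tx(5)[of m] by linarith
      then show ?thesis using tx(1)[of m]
        by (simp add: scaleR_conv_of_real qform_mult qform_diff mult_nonneg_nonpos flip: of_real_inverse)
    qed
    then show "\<exists>N. \<forall>m\<ge>N. Re (qform n (\<lambda>j k. (H (t (r m)) j k - H 0 j k) /\<^sub>R t (r m)) (x (r m))) \<le> 0"
      by blast
  qed
  ultimately show False by simp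
qed

text \<open>Write p, q, r for the numbers of positive, negative and zero eigenvalues of
  \<open>H 0\<close>. Just right of 0 at most q eigenvalues are negative, so the signature is at
  least n - 2q; just left at most p are positive, so it is at most 2p - n. The gap is at least 2r,
  and r > 0 by singularity.\<close>

lemma definite_kernel_changes_signature:
  fixes H :: "real \<Rightarrow> complex mat"
  assumes carrier: "\<And>t. H t \<in> carrier_mat n n"
    and herm: "\<And>t j k. j < n \<Longrightarrow> k < n \<Longrightarrow> H t $$ (j, k) = cnj (H t $$ (k, j))"
    and deriv: "\<And>j k. j < n \<Longrightarrow> k < n \<Longrightarrow> ((\<lambda>t. H t $$ (j, k)) has_vector_derivative H' j k) (at 0)"
    and sing: "det (H 0) = 0"
    and reg: "\<forall>\<^sub>F t in at 0. det (H t) \<noteq> 0 \<and> int (nu_pos (H t)) - int (nu_neg (H t)) = c"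
    and pos: "\<And>x. \<exists>k<n. x k \<noteq> 0 \<Longrightarrow> \<forall>j<n. (\<Sum>k<n. H 0 $$ (j, k) * x k) = 0 \<Longrightarrow> Re (qform n H' x) > 0"
  shows False
proof -
  define E where "E t j k = H t $$ (j, k)" for t j k
  have deriv_E: "((\<lambda>t. E t j k) has_vector_derivative H' j k) (at 0)" if "j < n" "k < n" for j k
    using deriv[OF that] by (simp add: E_def)
  \<comment> \<open>Reflecting the parameter and negating the matrix preserves the derivative at 0
    and the kernel of \<open>H 0\<close> but turns its eigenvalue signs over, so the one-sided
    perturbation result covers the left side too.\<close>
  have deriv_neg: "((\<lambda>t. - E (- t) j k) has_vector_derivative H' j k) (at 0)" if "j < n" "k < n" for j k
  proof -
    have "(uminus has_vector_derivative - 1) (at (0 :: real))"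
      by (auto intro!: derivative_eq_intros)
    from vector_diff_chain_at[OF this, of "\<lambda>t. E t j k" "H' j k"] deriv_E[OF that]
    have "((\<lambda>t. E (- t) j k) has_vector_derivative - H' j k) (at 0)" by (simp add: o_def)
    from has_vector_derivative_minus[OF this] show ?thesis by simp
  qed
  have spectral: "\<exists>w d. spectral_form n (E t) w d \<and> det (H t) = (\<Prod>i<n. of_real (d i)) \<and>
      nu_pos (H t) = card {i. i < n \<and> d i > 0} \<and> nu_neg (H t) = card {i. i < n \<and> d i < 0}" for t
  proof (rule hermitian_spectral_form[of "H t" n])
    show "H t $$ (j, k) = cnj (H t $$ (k, j))" if "j < n" "k < n" for j k using that by (rule herm)
  next
    fix w d
    assume "\<And>j k. j < n \<Longrightarrow> k < n \<Longrightarrow> H t $$ (j, k) = (\<Sum>i<n. of_real (d i) * w i j * cnj (w i k))"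
      "nu_pos (H t) = card {i. i < n \<and> d i > 0}" "nu_neg (H t) = card {i. i < n \<and> d i < 0}"
      "det (H t) = (\<Prod>i<n. of_real (d i))"
    then show ?thesis
      by (intro exI[of _ w] exI[of _ d]) (simp add: spectral_form_def E_def)
  qed (rule carrier)
  obtain w d where sp: "spectral_form n (E 0) w d" and det0: "det (H 0) = (\<Prod>i<n. of_real (d i))"
    using spectral by blast
  have spec_neg: "spectral_form n (\<lambda>j k. - E (- 0) j k) w (\<lambda>i. - d i)"
    using spectral_form_uminus[OF sp] by simp
  define P where "P t \<longleftrightarrow> (\<forall>x. (\<exists>k<n. x k \<noteq> 0) \<longrightarrow>
      (\<forall>i\<in>{i. i < n \<and> d i < 0}. (\<Sum>k<n. cnj (w i k) * x k) = 0) \<longrightarrow> Re (qform n (E t) x) > 0)" for t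
  define Q where "Q t \<longleftrightarrow> (\<forall>x. (\<exists>k<n. x k \<noteq> 0) \<longrightarrow>
      (\<forall>i\<in>{i. i < n \<and> - d i < 0}. (\<Sum>k<n. cnj (w i k) * x k) = 0) \<longrightarrow>
      Re (qform n (\<lambda>j k. - E (- t) j k) x) > 0)" for t
  define R where "R t \<longleftrightarrow> det (H t) \<noteq> 0 \<and> int (nu_pos (H t)) - int (nu_neg (H t)) = c" for t
  have "\<forall>\<^sub>F t in at_right 0. P t"
    unfolding P_def by (rule perturbation_positive[OF deriv_E sp]) (auto simp: E_def intro!: pos)
  moreover have "\<forall>\<^sub>F t in at_right 0. Q t"
    unfolding Q_def
    by (rule perturbation_positive[OF deriv_neg spec_neg]) (auto simp: E_def sum_negf intro!: pos)
  moreover have "\<forall>\<^sub>F t in at_right 0. R t \<and> R (- t)"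
  proof -
    obtain e where e: "e > 0" "\<And>t. t \<noteq> 0 \<Longrightarrow> dist t 0 < e \<Longrightarrow> R t"
      using reg unfolding R_def[symmetric] eventually_at by blast
    then show ?thesis unfolding eventually_at_right_field by (intro exI[of _ e]) auto
  qed
  ultimately have "\<forall>\<^sub>F t in at_right 0. P t \<and> Q t \<and> R t \<and> R (- t)"
    by (simp add: eventually_conj_iff)
  then obtain t where t: "P t" "Q t" "R t" "R (- t)"
    using eventually_happens'[OF trivial_limit_at_right_real] by blast
  have pos_t: "Re (qform n (E t) x) > 0"
    if "\<exists>k<n. x k \<noteq> 0" "\<forall>i\<in>{i. i < n \<and> d i < 0}. (\<Sum>k<n. cnj (w i k) * x k) = 0" for x
    using t(1) that unfolding P_def by blast
  have neg_t: "Re (qform n (\<lambda>j k. - E (- t) j k) x) > 0"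
    if "\<exists>k<n. x k \<noteq> 0" "\<forall>i\<in>{i. i < n \<and> - d i < 0}. (\<Sum>k<n. cnj (w i k) * x k) = 0" for x
    using t(2) that unfolding Q_def by blast
  have reg_t: "det (H t) \<noteq> 0" "int (nu_pos (H t)) - int (nu_neg (H t)) = c"
      "det (H (- t)) \<noteq> 0" "int (nu_pos (H (- t))) - int (nu_neg (H (- t))) = c"
    using t(3,4) by (simp_all add: R_def)
  have split: "card {i. i < n \<and> f i > 0} + card {i. i < n \<and> f i < 0} + card {i. i < n \<and> f i = 0} = n" for f :: "nat \<Rightarrow> real"
  proof -
    have "card {..<n} = card ({i. i < n \<and> f i > 0} \<union> {i. i < n \<and> f i < 0} \<union> {i. i < n \<and> f i = 0})"
      by (rule arg_cong[of _ _ card]) auto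
    also have "\<dots> = card ({i. i < n \<and> f i > 0} \<union> {i. i < n \<and> f i < 0}) + card {i. i < n \<and> f i = 0}"
      by (rule card_Un_disjoint) auto
    also have "card ({i. i < n \<and> f i > 0} \<union> {i. i < n \<and> f i < 0}) = card {i. i < n \<and> f i > 0} + card {i. i < n \<and> f i < 0}"
      by (rule card_Un_disjoint) auto
    finally show ?thesis by simp
  qed
  have regular: "card {i. i < n \<and> f i = 0} = 0" if "det M = (\<Prod>i<n. of_real (f i))" "det M \<noteq> 0"
    for f :: "nat \<Rightarrow> real" and M :: "complex mat"
    using that by (auto simp: prod_zero_iff)
  obtain w1 d1 where 1: "spectral_form n (E t) w1 d1" "det (H t) = (\<Prod>i<n. of_real (d1 i))"
      "nu_pos (H t) = card {i. i < n \<and> d1 i > 0}" "nu_neg (H t) = card {i. i < n \<and> d1 i < 0}"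
    using spectral by blast
  obtain w2 d2 where 2: "spectral_form n (E (- t)) w2 d2" "det (H (- t)) = (\<Prod>i<n. of_real (d2 i))"
      "nu_pos (H (- t)) = card {i. i < n \<and> d2 i > 0}" "nu_neg (H (- t)) = card {i. i < n \<and> d2 i < 0}"
    using spectral by blast
  have "card {i. i < n \<and> d1 i \<le> 0} \<le> card {i. i < n \<and> d i < 0}"
    by (rule card_nonpos_le_codim[OF 1(1) _ pos_t]) auto
  moreover have "card {i. i < n \<and> d1 i < 0} \<le> card {i. i < n \<and> d1 i \<le> 0}"
    by (rule card_mono) auto
  moreover have "card {i. i < n \<and> - d2 i \<le> 0} \<le> card {i. i < n \<and> - d i < 0}"
    by (rule card_nonpos_le_codim[OF spectral_form_uminus[OF 2(1)] _ neg_t]) auto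
  moreover have "card {i. i < n \<and> d2 i > 0} \<le> card {i. i < n \<and> - d2 i \<le> 0}"
    by (rule card_mono) auto
  moreover have "card {i. i < n \<and> d i = 0} > 0"
    using sing det0 by (auto simp: prod_zero_iff card_gt_0_iff)
  ultimately show False
    using split[of d] split[of d1] split[of d2] regular[OF 1(2) reg_t(1)] regular[OF 2(2) reg_t(3)]
      reg_t(2,4) unfolding 1(3,4) 2(3,4) neg_less_0_iff_less by linarith
qed

section \<open>From anisotropic to definite forms\<close>

lemma hermitian_qform_real:
  assumes "\<And>j k. j < n \<Longrightarrow> k < n \<Longrightarrow> M j k = cnj (M k j)"
  shows "Im (qform n M x) = 0"
proof -
  have "cnj (qform n M x) = (\<Sum>j<n. \<Sum>k<n. cnj (x k) * M k j * x j)"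
    unfolding qform_def cnj_sum
  proof (intro sum.cong refl)
    fix j k assume "j \<in> {..<n}" "k \<in> {..<n}"
    then have "M k j = cnj (M j k)" by (intro assms) auto
    then show "cnj (cnj (x j) * M j k * x k) = cnj (x k) * M k j * x j" by (simp add: mult_ac)
  qed
  also have "\<dots> = qform n M x" unfolding qform_def by (rule sum.swap)
  finally show ?thesis by (simp add: complex_eq_iff)
qed

text \<open>The intermediate value theorem on the segment from \<open>y\<close> to \<open>x\<close>
  gives a zero of the form. It is not the zero vector: s x = (s - 1) y would equate s^2 times a
  positive number with (s - 1)^2 times a negative one, forcing both s = 0 and s = 1.\<close>

lemma indefinite_form_isotropic:
  assumes herm: "\<And>j k. j < n \<Longrightarrow> k < n \<Longrightarrow> M j k = cnj (M k j)"
    and x: "Re (qform n M x) > 0" and y: "Re (qform n M y) < 0"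
  obtains s :: real where "\<exists>k<n. of_real s * x k + of_real (1 - s) * y k \<noteq> 0"
    "qform n M (\<lambda>k. of_real s * x k + of_real (1 - s) * y k) = 0"
proof -
  define z where "z s k = complex_of_real s * x k + of_real (1 - s) * y k" for s k
  have "z 0 = y" "z 1 = x" by (simp_all add: z_def fun_eq_iff)
  moreover have "continuous_on {0..1} (\<lambda>s. Re (qform n M (z s)))"
    unfolding qform_def z_def by (intro continuous_intros)
  ultimately obtain s where s: "0 \<le> s" "s \<le> 1" "Re (qform n M (z s)) = 0"
    using IVT'[of "\<lambda>s. Re (qform n M (z s))" 0 0 1] x y by auto
  have "\<exists>k<n. z s k \<noteq> 0"
  proof (rule ccontr)
    assume "\<not> ?thesis"
    then have "of_real s * x k = of_real (s - 1) * y k" if "k < n" for k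
      using that by (auto simp: z_def algebra_simps)
    then have "qform n M (\<lambda>k. of_real s * x k) = qform n M (\<lambda>k. of_real (s - 1) * y k)"
      by (intro qform_cong) auto
    then have "s\<^sup>2 * Re (qform n M x) = (s - 1)\<^sup>2 * Re (qform n M y)"
      unfolding qform_scale by (drule_tac arg_cong[of _ _ Re]) (simp del: of_real_power)
    moreover have "s\<^sup>2 * Re (qform n M x) \<ge> 0" "(s - 1)\<^sup>2 * Re (qform n M y) \<le> 0"
      using x y by (auto intro: mult_nonneg_nonpos)
    ultimately have "s\<^sup>2 * Re (qform n M x) = 0" "(s - 1)\<^sup>2 * Re (qform n M y) = 0" by linarith+
    then show False using x y by simp
  qed
  moreover have "qform n M (z s) = 0"
    using s(3) hermitian_qform_real[OF herm] by (simp add: complex_eq_iff)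
  ultimately show ?thesis using that[of s] by (simp add: z_def[abs_def])
qed

text \<open>The kernel is a subspace, so without isotropic vectors in it the form of
  \<open>H'\<close> has a single sign there. The positive case makes the signature jump, and the
  negative case is the positive one with the parameter reversed.\<close>

theorem constant_signature_isotropic_kernel_vector:
  fixes H :: "real \<Rightarrow> complex mat"
  assumes carrier: "\<And>t. H t \<in> carrier_mat n n"
    and herm: "\<And>t j k. j < n \<Longrightarrow> k < n \<Longrightarrow> H t $$ (j, k) = cnj (H t $$ (k, j))"
    and deriv: "\<And>j k. j < n \<Longrightarrow> k < n \<Longrightarrow> ((\<lambda>t. H t $$ (j, k)) has_vector_derivative H' j k) (at 0)"
    and sing: "det (H 0) = 0"
    and reg: "\<forall>\<^sub>F t in at 0. det (H t) \<noteq> 0 \<and> int (nu_pos (H t)) - int (nu_neg (H t)) = c"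
  shows "\<exists>x. (\<exists>k<n. x k \<noteq> 0) \<and> (\<forall>j<n. (\<Sum>k<n. H 0 $$ (j, k) * x k) = 0) \<and> qform n H' x = 0"
proof (rule ccontr)
  assume none: "\<not> ?thesis"
  define K where "K x \<longleftrightarrow> (\<forall>j<n. (\<Sum>k<n. H 0 $$ (j, k) * x k) = 0)" for x
  have aniso: "qform n H' x \<noteq> 0" if "\<exists>k<n. x k \<noteq> 0" "K x" for x
    using none that unfolding K_def by blast
  \<comment> \<open>Conjugation commutes with real differentiation, so uniqueness of derivatives
    transfers the symmetry from \<open>H t\<close> to \<open>H'\<close>.\<close>
  have herm': "H' j k = cnj (H' k j)" if "j < n" "k < n" for j k
  proof -
    have "((\<lambda>t. cnj (H t $$ (k, j))) has_vector_derivative cnj (H' k j)) (at 0)"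
      using deriv[OF that(2,1)] by (rule has_vector_derivative_cnj)
    then have "((\<lambda>t. H t $$ (j, k)) has_vector_derivative cnj (H' k j)) (at 0)"
      using herm[OF that] by simp
    with deriv[OF that] show ?thesis by (rule vector_derivative_unique_at)
  qed
  have real: "Im (qform n H' x) = 0" for x by (rule hermitian_qform_real[OF herm'])
  have K_comb: "K (\<lambda>k. a * x k + b * y k)" if "K x" "K y" for a b x y
  proof -
    have "(\<Sum>k<n. H 0 $$ (j, k) * (a * x k + b * y k))
        = a * (\<Sum>k<n. H 0 $$ (j, k) * x k) + b * (\<Sum>k<n. H 0 $$ (j, k) * y k)" for j
      by (simp add: sum_distrib_left sum.distrib algebra_simps)
    then show ?thesis using that by (simp add: K_def)
  qed
  have same_sign: False if "K x" "K y" "Re (qform n H' x) > 0" "Re (qform n H' y) < 0" for x y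
  proof (rule indefinite_form_isotropic[of n H' x y])
    show "H' j k = cnj (H' k j)" if "j < n" "k < n" for j k using that by (rule herm')
  next
    fix s :: real
    assume "\<exists>k<n. of_real s * x k + of_real (1 - s) * y k \<noteq> 0"
      "qform n H' (\<lambda>k. of_real s * x k + of_real (1 - s) * y k) = 0"
    then show False using aniso[OF _ K_comb[OF that(1,2)]] by blast
  qed (use that in auto)
  have cases: "Re (qform n H' x) > 0 \<or> Re (qform n H' x) < 0" if "\<exists>k<n. x k \<noteq> 0" "K x" for x
    using aniso[OF that] real[of x] by (auto simp: complex_eq_iff)
  have "(\<forall>x. (\<exists>k<n. x k \<noteq> 0) \<longrightarrow> K x \<longrightarrow> Re (qform n H' x) > 0) \<or>
        (\<forall>x. (\<exists>k<n. x k \<noteq> 0) \<longrightarrow> K x \<longrightarrow> Re (qform n H' x) < 0)"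
    using same_sign cases by metis
  then show False
  proof
    assume pos: "\<forall>x. (\<exists>k<n. x k \<noteq> 0) \<longrightarrow> K x \<longrightarrow> Re (qform n H' x) > 0"
    show False
    proof (rule definite_kernel_changes_signature[of H n H' c])
      show "H t $$ (j, k) = cnj (H t $$ (k, j))" if "j < n" "k < n" for t j k using that by (rule herm)
      show "Re (qform n H' x) > 0"
        if "\<exists>k<n. x k \<noteq> 0" "\<forall>j<n. (\<Sum>k<n. H 0 $$ (j, k) * x k) = 0" for x
        using pos that unfolding K_def by blast
    qed (fact carrier deriv sing reg)+
  next
    assume neg: "\<forall>x. (\<exists>k<n. x k \<noteq> 0) \<longrightarrow> K x \<longrightarrow> Re (qform n H' x) < 0"
    show False
    \<comment> \<open>Reversal negates the derivative but keeps \<open>H 0\<close> and the punctured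
      neighbourhood on which the signature is constant.\<close>
    proof (rule definite_kernel_changes_signature[of "\<lambda>t. H (- t)" n "\<lambda>j k. - H' j k" c])
      show "H (- t) $$ (j, k) = cnj (H (- t) $$ (k, j))" if "j < n" "k < n" for t j k
        using that by (rule herm)
      show "Re (qform n (\<lambda>j k. - H' j k) x) > 0"
        if "\<exists>k<n. x k \<noteq> 0" "\<forall>j<n. (\<Sum>k<n. H (- 0) $$ (j, k) * x k) = 0" for x
        using neg that unfolding K_def qform_uminus by simp
      show "det (H (- 0)) = 0" using sing by simp
      show "((\<lambda>t. H (- t) $$ (j, k)) has_vector_derivative - H' j k) (at 0)" if "j < n" "k < n" for j k
      proof -
        have "(uminus has_vector_derivative - 1) (at (0 :: real))"
          by (auto intro!: derivative_eq_intros)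
        from vector_diff_chain_at[OF this, of "\<lambda>t. H t $$ (j, k)" "H' j k"] deriv[OF that]
        show ?thesis by (simp add: o_def)
      qed
      show "\<forall>\<^sub>F t in at 0. det (H (- t)) \<noteq> 0 \<and> int (nu_pos (H (- t))) - int (nu_neg (H (- t))) = c"
      proof -
        obtain e where "e > 0" "\<And>t. t \<noteq> 0 \<Longrightarrow> dist t 0 < e \<Longrightarrow> det (H t) \<noteq> 0 \<and> int (nu_pos (H t)) - int (nu_neg (H t)) = c"
          using reg unfolding eventually_at by auto
        then show ?thesis unfolding eventually_at by (intro exI[of _ e]) auto
      qed
    qed (fact carrier)
  qed
qed

section \<open>Splitting off a root of the determinant\<close>

lemma det_zero_row:
  fixes M :: "'a :: comm_ring_1 mat"
  assumes "M \<in> carrier_mat n n" "r < n" "\<And>j. j < n \<Longrightarrow> M $$ (r, j) = 0"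
  shows "det M = 0"
proof -
  have zero: "(\<Prod>i = 0..<n. M $$ (i, p i)) = 0" if "p permutes {0..<n}" for p
    using assms permutes_in_image[OF that, of r] by (intro prod_zero bexI[of _ r]) auto
  show ?thesis
    unfolding det_def'[OF assms(1)]
    by (intro sum.neutral ballI) (simp only: zero mem_Collect_eq mult_zero_right)
qed

lemma det_zero_col:
  fixes M :: "'a :: comm_ring_1 mat"
  assumes "M \<in> carrier_mat n n" "r < n" "\<And>i. i < n \<Longrightarrow> M $$ (i, r) = 0"
  shows "det M = 0"
  using det_zero_row[of "transpose_mat M" n r] det_transpose[OF assms(1)] assms by simp

lemma lp_signof: "is_lp (signof p)" "lp_eval (signof p) z = signof p"
  using lp_eval_uminus[OF is_lp_1, of z] by (auto simp: sign_def)

lemma is_lp_det: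
  assumes A: "A \<in> carrier_mat n n" "lp_mat A"
  shows "is_lp (det A)"
proof -
  have "is_lp (A $$ (i, p i))" if "p permutes {0..<n}" "i \<in> {0..<n}" for p i
    using A that permutes_in_image[OF that(1), of i] by (auto simp: lp_mat_def)
  then show "is_lp (det A)"
    unfolding det_def'[OF A(1)] by (intro is_lp_sum is_lp_mult lp_signof is_lp_prod) auto
qed

text \<open>Evaluation passes through the Leibniz formula. It is multiplicative only on finitely
  supported series, so every product is certified as a Laurent polynomial on the way.\<close>

lemma lp_eval_det:
  assumes A: "A \<in> carrier_mat n n" and lp: "lp_mat A" and z: "z \<noteq> 0"
  shows "lp_eval (det A) z = det (lp_mat_eval A z)"
proof -
  have E: "lp_mat_eval A z \<in> carrier_mat n n" using A by (simp add: lp_mat_eval_def)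
  have is_lp: "is_lp (A $$ (i, p i))" if "p permutes {0..<n}" "i \<in> {0..<n}" for p i
    using A lp that permutes_in_image[OF that(1), of i] by (auto simp: lp_mat_def)
  have prod_lp: "is_lp (\<Prod>i = 0..<n. A $$ (i, p i))" if "p permutes {0..<n}" for p
    using is_lp[OF that] by (intro is_lp_prod) auto
  have "lp_eval (det A) z
      = (\<Sum>p | p permutes {0..<n}. lp_eval (signof p * (\<Prod>i = 0..<n. A $$ (i, p i))) z)"
    unfolding det_def'[OF A] by (intro lp_eval_sum is_lp_mult lp_signof prod_lp) auto
  also have "\<dots> = (\<Sum>p | p permutes {0..<n}. signof p * (\<Prod>i = 0..<n. lp_eval (A $$ (i, p i)) z))"
  proof (intro sum.cong refl)
    fix p assume "p \<in> {p. p permutes {0..<n}}"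
    then have p: "p permutes {0..<n}" by simp
    show "lp_eval (signof p * (\<Prod>i = 0..<n. A $$ (i, p i))) z = signof p * (\<Prod>i = 0..<n. lp_eval (A $$ (i, p i)) z)"
      unfolding lp_eval_mult[OF z lp_signof(1) prod_lp[OF p]] lp_signof(2)
      by (subst lp_eval_prod[OF z]) (use is_lp[OF p] in auto)
  qed
  also have "\<dots> = det (lp_mat_eval A z)"
    unfolding det_def'[OF E]
  proof (intro sum.cong refl arg_cong2[of _ _ _ _ "(*)"] prod.cong)
    fix p i assume "p \<in> {p. p permutes {0..<n}}" "i \<in> {0..<n}"
    then show "lp_eval (A $$ (i, p i)) z = lp_mat_eval A z $$ (i, p i)"
      using A permutes_in_image[of p "{0..<n}" i] by (auto simp: lp_mat_eval_def)
  qed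
  finally show ?thesis .
qed

lemma lp_len_nonneg: "is_lp f \<Longrightarrow> f \<noteq> 0 \<Longrightarrow> lp_len f \<ge> 0"
  by (erule lp_normal_form) (auto simp: lp_len_normal_form)

lemma lp_len_root:
  assumes "is_lp f" "f \<noteq> 0" "z \<noteq> 0" "lp_eval f z = 0"
  shows "lp_len f \<ge> 1"
proof -
  obtain g where g: "is_lp g" "f = X_minus z * g" using lp_root_factor assms(1,3,4) by blast
  with assms(2) have "g \<noteq> 0" "X_minus z \<noteq> 0" by auto
  then show ?thesis using g lp_len_nonneg[OF g(1)] lp_len_mult[of "X_minus z" g] lp_len_X_minus[OF assms(3)] by simp
qed

text \<open>\<open>F\<close> may contain \<open>z0\<close> itself. Its other points stay away by
  continuity, and \<open>z0\<close> is avoided because \<open>cis t\<close> differs from 1 for 0 <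
  |t| < pi.\<close>

lemma eventually_circle_avoids_finite:
  assumes "finite F" "z0 \<noteq> 0"
  shows "\<forall>\<^sub>F t in at 0. z0 * cis t \<notin> F"
proof -
  have cont: "((\<lambda>t. z0 * cis t) \<longlongrightarrow> z0) (at 0)"
    by (rule tendsto_eq_intros refl | simp add: isCont_def[symmetric])+
  have "open (- (F - {z0}))" using assms(1) by (intro open_Compl finite_imp_closed) auto
  then have "\<forall>\<^sub>F t in at 0. z0 * cis t \<in> - (F - {z0})"
    using topological_tendstoD[OF cont, of "- (F - {z0})"] by blast
  moreover have "\<forall>\<^sub>F t in at (0 :: real). t \<noteq> 0 \<and> \<bar>t\<bar> < pi"
    unfolding eventually_at by (intro exI[of _ pi]) auto
  ultimately show ?thesis
  proof eventually_elim
    case (elim t)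
    then have "sin t \<noteq> 0" using sin_gt_zero[of t] sin_gt_zero[of "- t"] by (cases "t > 0") auto
    then have "cis t \<noteq> 1" by (auto simp: complex_eq_iff)
    then have "z0 * cis t \<noteq> z0" using assms(2) by auto
    then show ?case using elim by auto
  qed
qed

lemma X_minus_star_monom:
  assumes "cmod w = 1"
  shows "lp_star (X_minus w) * lp_monom (- w) 1 = X_minus w"
proof -
  have "cnj w * w = 1" using assms complex_norm_square[of w] by (simp add: mult.commute)
  then have "lp_monom (- cnj w) (-1) * lp_monom (- w) 1 = 1"
    by (intro fls_eqI) auto
  then show ?thesis
    unfolding X_minus_star[OF assms] by (metis mult.assoc mult.commute mult.right_neutral)
qed

text \<open>\<open>U\<close> is the inverse adjoint of the matrix with \<open>k\<close>-th column \<open>v\<close> and unit vectors elsewhere,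
  with its \<open>k\<close>-th column multiplied by \<open>X - z0\<close>; accordingly \<open>At\<close> is the transformed \<open>A\<close> with row and
  column \<open>k\<close> divided by \<open>X - z0\<close> and its star.\<close>

lemma deflate_isotropic_kernel_vector:
  fixes A :: "complex fls mat" and v :: "nat \<Rightarrow> complex"
  assumes A: "A \<in> carrier_mat n n" "lp_mat A" "mat_star A = A" "det A \<noteq> 0"
    and z0: "cmod z0 = 1" and k: "k < n" "v k \<noteq> 0"
    and ker: "\<And>i. i < n \<Longrightarrow> is_lp (g i) \<and> (\<Sum>j<n. A $$ (i, j) * fls_const (v j)) = lp_star (X_minus z0) * g i"
    and iso: "is_lp h" "(\<Sum>i<n. \<Sum>j<n. fls_const (cnj (v i)) * A $$ (i, j) * fls_const (v j)) = X_minus z0 * lp_star (X_minus z0) * h"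
  shows "\<exists>U At. U \<in> carrier_mat n n \<and> At \<in> carrier_mat n n \<and> lp_mat U \<and> lp_mat At \<and>
           mat_star At = At \<and> A = U * At * mat_star U \<and>
           lp_len (det At) \<le> lp_len (det A) - 2"
proof -
  let ?l = "X_minus z0" and ?C = fls_const
  have z0_nz: "z0 \<noteq> 0" using z0 by auto
  have "fls_nth ?l 1 = 1" by (simp add: X_minus_def)
  then have l_nz: "?l \<noteq> 0" by auto
  then have ls_nz: "lp_star ?l \<noteq> 0" by (metis is_lp_X_minus lp_star_0 lp_star_star)
  have A_lp: "is_lp (A $$ (i, j))" if "i < n" "j < n" for i j
    using A(1,2) that by (auto simp: lp_mat_def)
  have A_star: "lp_star (A $$ (i, j)) = A $$ (j, i)" if "i < n" "j < n" for i j
    using arg_cong[OF A(3), of "\<lambda>M. M $$ (j, i)"] A(1) that by (simp add: mat_star_def)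
  have g_lp: "is_lp (g i)" if "i < n" for i using ker that by blast
  have Av: "(\<Sum>j<n. A $$ (i, j) * ?C (v j)) = lp_star ?l * g i" if "i < n" for i using ker that by blast
  have vA: "(\<Sum>j<n. ?C (cnj (v j)) * A $$ (j, i)) = ?l * lp_star (g i)" if "i < n" for i
  proof -
    have "(\<Sum>j<n. ?C (cnj (v j)) * A $$ (j, i)) = lp_star (\<Sum>j<n. A $$ (i, j) * ?C (v j))"
      using A_lp A_star that by (subst lp_star_sum) (auto simp: lp_star_mult mult.commute)
    then show ?thesis using g_lp[OF that] by (simp add: Av[OF that] lp_star_mult)
  qed
  \<comment> \<open>Both v^* A v and the product of \<open>?l\<close> with its star are fixed by the
    star; cancelling that nonzero product leaves the same for \<open>h\<close>.\<close>
  have h_star: "lp_star h = h"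
  proof -
    have "lp_star (?l * lp_star ?l * h) = (\<Sum>i<n. lp_star (\<Sum>j<n. ?C (cnj (v i)) * A $$ (i, j) * ?C (v j)))"
      unfolding iso(2)[symmetric] using A_lp by (intro lp_star_sum is_lp_sum is_lp_mult) auto
    also have "\<dots> = (\<Sum>i<n. \<Sum>j<n. ?C (cnj (v j)) * A $$ (j, i) * ?C (v i))"
    proof (intro sum.cong refl)
      fix i assume "i \<in> {..<n}"
      then show "lp_star (\<Sum>j<n. ?C (cnj (v i)) * A $$ (i, j) * ?C (v j))
          = (\<Sum>j<n. ?C (cnj (v j)) * A $$ (j, i) * ?C (v i))"
        using A_lp A_star by (subst lp_star_sum) (auto simp: lp_star_mult mult_ac)
    qed
    also have "\<dots> = ?l * lp_star ?l * h"
      unfolding iso(2)[symmetric] by (rule sum.swap)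
    finally have "?l * lp_star ?l * lp_star h = ?l * lp_star ?l * h"
      using iso(1) by (simp add: lp_star_mult mult_ac)
    then show ?thesis using l_nz ls_nz by simp
  qed
  \<comment> \<open>Computing v^* A v through \<open>vA\<close> exhibits one factor
    \<open>?l\<close>. Cancelling it gives row k of \<open>At\<close> the kind of relation that
    \<open>Av\<close> gives the other rows.\<close>
  have gh: "(\<Sum>j<n. lp_star (g j) * ?C (v j)) = lp_star ?l * h"
  proof -
    have "?l * (\<Sum>j<n. lp_star (g j) * ?C (v j)) = (\<Sum>j<n. (\<Sum>i<n. ?C (cnj (v i)) * A $$ (i, j)) * ?C (v j))"
      by (simp add: vA sum_distrib_left mult.assoc)
    also have "\<dots> = ?l * (lp_star ?l * h)"
      unfolding mult.assoc[symmetric] iso(2)[symmetric] sum_distrib_right by (rule sum.swap)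
    finally show ?thesis using l_nz by simp
  qed
  have split: "(\<Sum>j<n. f j) = (\<Sum>j\<in>{..<n} - {k}. f j) + f k" for f :: "nat \<Rightarrow> complex fls"
    using k(1) by (subst sum.remove[of _ k]) (auto simp: add.commute)
  define c where "c = ?C (1 / v k)"
  have c: "c * ?C (v k) = 1" using k(2) by (simp add: c_def)
  \<comment> \<open>With P the basis matrix having \<open>v\<close> as column k, P^(-1) has
    \<open>c\<close> at (k, k), entries \<open>- c * v i\<close> in the rest of column k, and unit
    columns elsewhere; \<open>v k \<noteq> 0\<close> is the pivot. \<open>R\<close> is P^(-1) with
    row k multiplied by \<open>lp_star ?l\<close>.\<close>
  define R where "R = mat n n (\<lambda>(i, j). if i = k then (if j = k then c * lp_star ?l else 0)
      else if j = k then - c * ?C (v i) else if i = j then 1 else 0)"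
  define At where "At = mat n n (\<lambda>(i, j). if i = k then (if j = k then h else lp_star (g j))
      else if j = k then g i else A $$ (i, j))"
  define U where "U = mat_star R"
  have R: "R \<in> carrier_mat n n" "lp_mat R" by (auto simp: R_def lp_mat_def c_def)
  have At: "At \<in> carrier_mat n n" "lp_mat At"
    using A_lp g_lp iso(1) by (auto simp: At_def lp_mat_def)
  have U: "U \<in> carrier_mat n n" "lp_mat U" using R by (auto simp: U_def mat_star_def lp_mat_def)
  have UR: "mat_star U = R" using R by (intro eq_matI) (auto simp: U_def mat_star_def lp_mat_def)
  have "mat_star At = At"
    using A_star g_lp h_star by (intro eq_matI) (auto simp: At_def mat_star_def)
  have AtR: "(At * R) $$ (i, j) = (if i = k then lp_star (g j) else A $$ (i, j))" if ij: "i < n" "j < n" for i j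
  proof -
    have "(At * R) $$ (i, j) = (\<Sum>m<n. At $$ (i, m) * R $$ (m, j))"
      using At R ij by (simp add: scalar_prod_def atLeast0LessThan)
    also have "\<dots> = (if i = k then lp_star (g j) else A $$ (i, j))"
    proof (cases "j = k")
      case False
      then have "(\<Sum>m<n. At $$ (i, m) * R $$ (m, j)) = (\<Sum>m<n. if m = j then At $$ (i, m) else 0)"
        using ij by (intro sum.cong) (auto simp: R_def)
      then show ?thesis using ij False by (simp add: At_def)
    next
      case True
      \<comment> \<open>\<open>a\<close> and \<open>b\<close> treat row k and the other rows
        together: both satisfy the relation \<open>sum_a\<close>. Column k of \<open>R\<close>
        subtracts all terms m \<noteq> k of that sum, which leaves \<open>a k\<close> after
        normalization by \<open>c\<close>.\<close>
      define a where "a m = (if i = k then lp_star (g m) else A $$ (i, m))" for m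
      define b where "b = (if i = k then h else g i)"
      have sum_a: "(\<Sum>m<n. a m * ?C (v m)) = lp_star ?l * b"
        using Av[OF ij(1)] gh by (auto simp: a_def b_def)
      have "(\<Sum>m<n. At $$ (i, m) * R $$ (m, j)) = (\<Sum>m\<in>{..<n} - {k}. - c * (a m * ?C (v m))) + b * (c * lp_star ?l)"
        unfolding split using True ij by (auto simp: R_def At_def a_def b_def mult_ac intro!: sum.cong)
      also have "\<dots> = c * (lp_star ?l * b - (\<Sum>m\<in>{..<n} - {k}. a m * ?C (v m)))"
        by (simp add: algebra_simps sum_negf flip: sum_distrib_left)
      also have "\<dots> = (c * ?C (v k)) * a k"
        unfolding sum_a[symmetric] split[of "\<lambda>m. a m * ?C (v m)"] by (simp add: mult_ac)
      finally show ?thesis unfolding c using True by (simp add: a_def)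
    qed
    finally show ?thesis .
  qed
  have "(U * (At * R)) $$ (i, j) = A $$ (i, j)" if ij: "i < n" "j < n" for i j
  proof -
    have U_entry: "U $$ (i, m) = lp_star (R $$ (m, i))" if "m < n" for m
      using R ij that by (simp add: U_def mat_star_def)
    have "(U * (At * R)) $$ (i, j) = (\<Sum>m<n. U $$ (i, m) * (At * R) $$ (m, j))"
      using U At R ij by (simp add: scalar_prod_def atLeast0LessThan)
    also have "\<dots> = A $$ (i, j)"
    proof (cases "i = k")
      case False
      then have "(\<Sum>m<n. U $$ (i, m) * (At * R) $$ (m, j)) = (\<Sum>m<n. if m = i then (At * R) $$ (m, j) else 0)"
        using ij by (intro sum.cong) (auto simp: U_entry R_def)
      then show ?thesis using ij False by (simp add: AtR)
    next
      case True
      define c' where "c' = ?C (1 / cnj (v k))"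
      have c': "lp_star c = c'" "c' * ?C (cnj (v k)) = 1" "is_lp c"
        using k(2) by (simp_all add: c_def c'_def)
      have Uk: "U $$ (i, m) = (if m = k then c' * ?l else - c' * ?C (cnj (v m)))" if "m < n" for m
        unfolding U_entry[OF that] using True ij that
        by (simp add: R_def c' lp_star_mult lp_star_uminus)
      have "(\<Sum>m<n. U $$ (i, m) * (At * R) $$ (m, j))
          = (\<Sum>m\<in>{..<n} - {k}. - c' * (?C (cnj (v m)) * A $$ (m, j))) + c' * ?l * lp_star (g j)"
        unfolding split using True ij
        by (simp add: Uk[unfolded True] AtR mult.assoc)
      also have "\<dots> = c' * (?l * lp_star (g j) - (\<Sum>m\<in>{..<n} - {k}. ?C (cnj (v m)) * A $$ (m, j)))"
        by (simp add: algebra_simps sum_negf flip: sum_distrib_left)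
      also have "\<dots> = (c' * ?C (cnj (v k))) * A $$ (k, j)"
        unfolding vA[OF ij(2), symmetric] split[of "\<lambda>m. ?C (cnj (v m)) * A $$ (m, j)"] by (simp add: mult_ac)
      finally show ?thesis unfolding c' using True by simp
    qed
    finally show ?thesis .
  qed
  then have "U * (At * R) = A"
    using U At R A(1) by (intro eq_matI) auto
  then have fact: "A = U * At * R" using U At R by simp
  then have det: "det A = det U * det At * det R"
    using U At R by (simp add: det_mult[of _ n])
  then have nz: "det U \<noteq> 0" "det At \<noteq> 0" "det R \<noteq> 0" using A(4) by auto
  note lps = is_lp_det[OF U] is_lp_det[OF At] is_lp_det[OF R]
  \<comment> \<open>Row k of \<open>R\<close> contains only zeros and a multiple of
    \<open>lp_star ?l\<close>, which vanishes at \<open>z0\<close> because \<open>z0\<close> lies on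
    the circle. So \<open>det R\<close> has a root and length at least 1; column k of
    \<open>U\<close> does the same for \<open>det U\<close>, and the lengths add.\<close>
  have "det (lp_mat_eval R z0) = 0"
    using R k(1) z0
    by (intro det_zero_row[of _ n k])
       (auto simp: lp_mat_eval_def R_def c_def lp_eval_mult lp_eval_star lp_eval_X_minus z0_nz)
  then have "lp_len (det R) \<ge> 1"
    using lp_len_root[OF lps(3) nz(3) z0_nz] lp_eval_det[OF R z0_nz] by simp
  moreover have "det (lp_mat_eval U z0) = 0"
    using R k(1) z0
    by (intro det_zero_col[of _ n k])
       (auto simp: U_def mat_star_def lp_mat_eval_def R_def c_def lp_star_mult lp_eval_mult lp_eval_star lp_eval_X_minus z0_nz)
  then have "lp_len (det U) \<ge> 1"
    using lp_len_root[OF lps(1) nz(1) z0_nz] lp_eval_det[OF U z0_nz] by simp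
  moreover have "lp_len (det A) = lp_len (det U) + lp_len (det At) + lp_len (det R)"
    unfolding det using nz lps by (simp add: lp_len_mult)
  ultimately have "lp_len (det At) \<le> lp_len (det A) - 2" by simp
  then show ?thesis using U At fact UR \<open>mat_star At = At\<close> by blast
qed

text \<open>Along the circle X - z0 has derivative i z0 \<noteq> 0, so the vanishing derivative of f
  = (X - z0) g forces g(z0) = 0 and a second linear factor splits off.\<close>

lemma lp_double_root_factor:
  assumes "is_lp f" "cmod z0 = 1" "lp_eval f z0 = 0"
    and "((\<lambda>t. lp_eval f (z0 * cis t)) has_vector_derivative 0) (at 0)"
  obtains h where "is_lp h" "f = X_minus z0 * lp_star (X_minus z0) * h"
proof -
  have z0: "z0 \<noteq> 0" using assms(2) by auto
  obtain g where g: "is_lp g" "f = X_minus z0 * g" using lp_root_factor assms(1,3) z0 by blast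
  obtain D where D: "((\<lambda>t. lp_eval g (z0 * cis t)) has_vector_derivative D) (at 0)"
    using lp_eval_circle_deriv[OF z0 g(1)] by blast
  have "((\<lambda>t. z0 * cis t - z0) has_vector_derivative z0 * \<i>) (at 0)"
    unfolding cis_conv_exp
    by (rule has_vector_derivative_eq_rhs, rule has_vector_derivative_real_field, (rule derivative_eq_intros refl | simp)+)
  from has_vector_derivative_mult[OF this D]
  have "((\<lambda>t. lp_eval f (z0 * cis t)) has_vector_derivative z0 * \<i> * lp_eval g z0) (at 0)"
    using g z0 by (simp add: lp_eval_mult lp_eval_X_minus)
  from vector_derivative_unique_at[OF this assms(4)] z0 have "lp_eval g z0 = 0" by simp
  then obtain g2 where g2: "is_lp g2" "g = X_minus z0 * g2" using lp_root_factor g(1) z0 by blast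
  show ?thesis
  proof (rule that)
    \<comment> \<open>The unit - z0 X, absorbed into the cofactor, turns the second linear factor
      into the star of the first.\<close>
    have "X_minus z0 * g2 = lp_star (X_minus z0) * (lp_monom (- z0) 1 * g2)"
      unfolding mult.assoc[symmetric] X_minus_star_monom[OF assms(2)] ..
    then show "f = X_minus z0 * lp_star (X_minus z0) * (lp_monom (- z0) 1 * g2)"
      unfolding g(2) g2(2) by (simp only: mult.assoc)
  qed (simp add: g2(1))
qed

section \<open>The factorization at a zero of the determinant on the circle\<close>

theorem theorem4p7:
  fixes A :: "complex fls mat" and n :: nat
  assumes "A \<in> carrier_mat n n" and "lp_mat A" and "mat_star A = A" and "det A \<noteq> 0"
    and "\<exists>c::int. \<forall>z. cmod z = 1 \<and> z \<notin> lp_sigma A \<longrightarrow>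
           int (nu_pos (lp_mat_eval A z)) - int (nu_neg (lp_mat_eval A z)) = c"
    and "\<exists>z0. z0 \<in> lp_sigma A \<and> cmod z0 = 1 \<and>
           (\<forall>E F d. smith_form n A E F d \<longrightarrow> (\<forall>j < n. order z0 (d j) \<le> 1))"
  shows "\<exists>U At. U \<in> carrier_mat n n \<and> At \<in> carrier_mat n n \<and> lp_mat U \<and> lp_mat At \<and>
           mat_star At = At \<and> A = U * At * mat_star U \<and>
           lp_len (det At) \<le> lp_len (det A) - 2"
proof -
  note A = assms(1-4)
  obtain c where c: "\<And>z. cmod z = 1 \<Longrightarrow> z \<notin> lp_sigma A \<Longrightarrow>
      int (nu_pos (lp_mat_eval A z)) - int (nu_neg (lp_mat_eval A z)) = c"
    using assms(5) by blast
  obtain z0 where z0: "det (lp_mat_eval A z0) = 0" "cmod z0 = 1" "z0 \<noteq> 0"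
    using assms(6) by (auto simp: lp_sigma_def)
  have A_lp: "is_lp (A $$ (i, j))" if "i < n" "j < n" for i j
    using A(1,2) that by (auto simp: lp_mat_def)
  have A_star: "A $$ (i, j) = lp_star (A $$ (j, i))" if "i < n" "j < n" for i j
    using arg_cong[OF A(3), of "\<lambda>M. M $$ (i, j)"] A(1) that by (simp add: mat_star_def)
  define H where "H t = lp_mat_eval A (z0 * cis t)" for t :: real
  have H: "H t \<in> carrier_mat n n" for t using A(1) by (simp add: H_def lp_mat_eval_def)
  have H_entry: "H t $$ (i, j) = lp_eval (A $$ (i, j)) (z0 * cis t)" if "i < n" "j < n" for t i j
    using A(1) that by (simp add: H_def lp_mat_eval_def)
  have on_circle: "cmod (z0 * cis t) = 1" for t using z0(2) by (simp add: norm_mult)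
  have "\<exists>D. ((\<lambda>t. lp_eval (A $$ (i, j)) (z0 * cis t)) has_vector_derivative D) (at 0)" if "i < n" "j < n" for i j
    using lp_eval_circle_deriv[OF z0(3) A_lp[OF that]] .
  then obtain H' where H': "((\<lambda>t. lp_eval (A $$ (i, j)) (z0 * cis t)) has_vector_derivative H' i j) (at 0)"
    if "i < n" "j < n" for i j by metis
  have "\<exists>x. (\<exists>k<n. x k \<noteq> 0) \<and> (\<forall>j<n. (\<Sum>k<n. H 0 $$ (j, k) * x k) = 0) \<and> qform n H' x = 0"
  proof (rule constant_signature_isotropic_kernel_vector[where c = c, OF H])
    show "H t $$ (j, k) = cnj (H t $$ (k, j))" if "j < n" "k < n" for t j k
      unfolding H_entry[OF that] H_entry[OF that(2,1)] lp_eval_star[OF on_circle A_lp[OF that(2,1)], symmetric]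
      by (simp only: A_star[OF that, symmetric])
    show "((\<lambda>t. H t $$ (j, k)) has_vector_derivative H' j k) (at 0)" if "j < n" "k < n" for j k
      using H'[OF that] by (simp add: H_entry[OF that])
    show "det (H 0) = 0" using z0(1) by (simp add: H_def)
    \<comment> \<open>\<open>det A\<close> has finitely many zeros, so for small t \<noteq> 0 the
      matrix is nonsingular and the hypothesis on the signature applies on both sides of
      \<open>z0\<close>.\<close>
    have "\<forall>\<^sub>F t in at 0. z0 * cis t \<notin> {z. z \<noteq> 0 \<and> lp_eval (det A) z = 0}"
      by (intro eventually_circle_avoids_finite finite_lp_zeros is_lp_det[OF A(1,2)] A(4) z0(3))
    then show "\<forall>\<^sub>F t in at 0. det (H t) \<noteq> 0 \<and> int (nu_pos (H t)) - int (nu_neg (H t)) = c"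
    proof eventually_elim
      case (elim t)
      then have "det (H t) \<noteq> 0" using z0(3) lp_eval_det[OF A(1,2)] by (simp add: H_def)
      then show ?case using c[OF on_circle[of t]] by (simp add: H_def lp_sigma_def)
    qed
  qed
  then obtain v where v: "\<exists>k<n. v k \<noteq> 0" "\<And>i. i < n \<Longrightarrow> (\<Sum>j<n. H 0 $$ (i, j) * v j) = 0" "qform n H' v = 0"
    by blast
  then obtain k where k: "k < n" "v k \<noteq> 0" by blast
  let ?C = fls_const
  have Av_zero: "lp_eval (\<Sum>j<n. A $$ (i, j) * ?C (v j)) z0 = 0" if "i < n" for i
    using v(2)[OF that] that A_lp z0(3) by (subst lp_eval_sum) (auto simp: lp_eval_mult H_entry)
  have "\<exists>g. is_lp g \<and> (\<Sum>j<n. A $$ (i, j) * ?C (v j)) = lp_star (X_minus z0) * g" if "i < n" for i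
  proof -
    note zero = Av_zero[OF that]
    have "is_lp (\<Sum>j<n. A $$ (i, j) * ?C (v j))" using A_lp that by (intro is_lp_sum is_lp_mult) auto
    then obtain g where "is_lp g" "(\<Sum>j<n. A $$ (i, j) * ?C (v j)) = X_minus z0 * g"
      using lp_root_factor z0(3) zero by blast
    \<comment> \<open>The root gives a factor X - z0, but the column is to be divided by its star so
      that the star operation matches it with the row divided by X - z0.\<close>
    moreover have "X_minus z0 * g = lp_star (X_minus z0) * (lp_monom (- z0) 1 * g)"
      unfolding mult.assoc[symmetric] X_minus_star_monom[OF z0(2)] ..
    ultimately show ?thesis
      by (intro exI[of _ "lp_monom (- z0) 1 * g"]) simp
  qed
  then obtain g where g: "\<And>i. i < n \<Longrightarrow> is_lp (g i) \<and> (\<Sum>j<n. A $$ (i, j) * ?C (v j)) = lp_star (X_minus z0) * g i"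
    by metis
  define f where "f = (\<Sum>i<n. \<Sum>j<n. ?C (cnj (v i)) * A $$ (i, j) * ?C (v j))"
  have f_lp: "is_lp f" unfolding f_def using A_lp by (intro is_lp_sum is_lp_mult) auto
  have f_eval: "lp_eval f z = (\<Sum>i<n. \<Sum>j<n. cnj (v i) * lp_eval (A $$ (i, j)) z * v j)" if "z \<noteq> 0" for z
  proof -
    have "lp_eval f z = (\<Sum>i<n. lp_eval (\<Sum>j<n. ?C (cnj (v i)) * A $$ (i, j) * ?C (v j)) z)"
      unfolding f_def using A_lp by (intro lp_eval_sum is_lp_sum is_lp_mult) auto
    also have "\<dots> = (\<Sum>i<n. \<Sum>j<n. cnj (v i) * lp_eval (A $$ (i, j)) z * v j)"
    proof (intro sum.cong refl)
      fix i assume "i \<in> {..<n}"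
      then show "lp_eval (\<Sum>j<n. ?C (cnj (v i)) * A $$ (i, j) * ?C (v j)) z
          = (\<Sum>j<n. cnj (v i) * lp_eval (A $$ (i, j)) z * v j)"
        using A_lp that by (subst lp_eval_sum) (auto simp: lp_eval_mult)
    qed
    finally show ?thesis .
  qed
  have "lp_eval f z0 = (\<Sum>i<n. cnj (v i) * (\<Sum>j<n. H 0 $$ (i, j) * v j))"
    using z0(3) by (simp add: f_eval H_entry sum_distrib_left mult.assoc)
  then have f_zero: "lp_eval f z0 = 0" by (simp add: v(2))
  \<comment> \<open>\<open>v\<close> does not depend on t, so this derivative is
    \<open>qform n H' v\<close>, which is 0 by the choice of \<open>v\<close>. With
    \<open>f_zero\<close> it supplies the double root.\<close>
  have "((\<lambda>t. \<Sum>i<n. \<Sum>j<n. cnj (v i) * lp_eval (A $$ (i, j)) (z0 * cis t) * v j)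
      has_vector_derivative (\<Sum>i<n. \<Sum>j<n. cnj (v i) * H' i j * v j)) (at 0)"
    using H' by (intro has_vector_derivative_sum has_vector_derivative_mult_left has_vector_derivative_mult_right) auto
  then have "((\<lambda>t. lp_eval f (z0 * cis t)) has_vector_derivative 0) (at 0)"
    using v(3) z0(3) by (simp add: f_eval qform_def)
  then obtain h where h: "is_lp h" "f = X_minus z0 * lp_star (X_minus z0) * h"
    by (rule lp_double_root_factor[OF f_lp z0(2) f_zero])
  show ?thesis
  proof (rule deflate_isotropic_kernel_vector[of A n z0 k v g h, OF A z0(2) k])
    show "is_lp (g i) \<and> (\<Sum>j<n. A $$ (i, j) * ?C (v j)) = lp_star (X_minus z0) * g i" if "i < n" for i
      using that by (rule g)
    show "is_lp h" by (rule h)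
    show "(\<Sum>i<n. \<Sum>j<n. ?C (cnj (v i)) * A $$ (i, j) * ?C (v j)) = X_minus z0 * lp_star (X_minus z0) * h"
      using h(2) by (simp only: f_def)
  qed
qed

end
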